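(* Assume that the objective function $F$ satisfies Assumption (F-basic) and that the diffusion coefficient $\sigma$ satisfies Assumption ($\sigma$-basic), as spelled out in the context. There exist positive real numbers $H\in(0,h_{\max})$ and $C\in(0,\infty)$ such that for any mapping $\varphi:\mathbb{R}^d\to\mathbb{R}$ of class $\mathcal{C}^2$ with bounded second order derivative, any initial value $x_0\in\mathbb{R}^d$ and any $h\in(0,H)$, \[ \sup_{N\in\mathbb{N}^\star}\big|\mathbb{E}[\varphi(X_N)]-\varphi(\mathcal{X}^0(Nh))\big|\le C_1(\varphi,x_0)h,\qquad C_1(\varphi,x_0)=C\bigl(\|\nabla\varphi(x^\star)\|+|||\varphi|||_2\bigr)\bigl(1+\|x_0-x^\star\|^3\bigr), \] where $(X_n)_{n\ge 0}$ is the stochastic gradient scheme with step size $h$ and $X_0=x_0$, and $\mathcal{X}^0$ is the solution of the gradient system $\frac{d\mathcal{X}^0(t)}{dt}=-\nabla F(\mathcal{X}^0(t))$, $t\ge0$, $\mathcal{X}^0(0)=x_0$.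
   Context: Notation: $\mathbb{N}=\{0,1,\dots\}$, $\mathbb{N}^\star=\{1,2,\dots\}$, $d\in\mathbb{N}^\star$; $\|\cdot\|$ is the Euclidean norm on $\mathbb{R}^d$ and the Frobenius norm on the space $\mathcal{M}_d(\mathbb{R})$ of real $d\times d$ matrices. For $\varphi:\mathbb{R}^d\to\mathbb{R}$ of class $\mathcal{C}^m$, $|||\varphi|||_m=\sup_{x\in\mathbb{R}^d}\sup_{k_1,\dots,k_m\neq0}\frac{|D^m\varphi(x).(k_1,\dots,k_m)|}{\|k_1\|\cdots\|k_m\|}$. A positive real number $h_{\max}$ is fixed; step sizes satisfy $h\in(0,h_{\max})$, and $t_n=nh$. Scheme: for deterministic $x_0\in\mathbb{R}^d$ and $h\in(0,h_{\max})$, $X_0=x_0$ and $X_{n+1}=X_n-h\nabla F(X_n)+h\sigma(t_n,X_n)\gamma_{n+1}$ for $n\in\mathbb{N}$, where $(\gamma_n)_{n\ge1}$ are independent standard centered Gaussian random variables in $\mathbb{R}^d$. Assumption (F-basic): $F:\mathbb{R}^d\to\mathbb{R}$ is of class $\mathcal{C}^3$; there is $L_F\in(0,\infty)$ with $\|\nabla F(x_2)-\nabla F(x_1)\|\le L_F\|x_2-x_1\|$ for all $x_1,x_2$; there is $\mu\in(0,\infty)$ with $\langle\nabla F(x_2)-\nabla F(x_1),x_2-x_1\rangle\ge\mu\|x_2-x_1\|^2$ for all $x_1,x_2$; the third order derivative of $F$ is bounded. Under this assumption $F$ has a unique minimizer, denoted $x^\star$. Assumption ($\sigma$-basic): $\sigma:[0,\infty)\times\mathbb{R}^d\to\mathcal{M}_d(\mathbb{R})$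 is continuous, and there is a bounded mapping $\varsigma:[0,\infty)\to[0,\infty)$ such that for all $t\ge0$: $\|\sigma(t,x_2)-\sigma(t,x_1)\|\le\varsigma(t)\|x_2-x_1\|$ for all $x_1,x_2\in\mathbb{R}^d$, and $\sup_{x\in\mathbb{R}^d}\frac{\|\sigma(t,x)\|}{1+\|x-x^\star\|}\le\varsigma(t)$. *)

theory Defs
  imports "HOL-Probability.Probability"
begin

text \<open>Points of d-dimensional space have type \<^typ>\<open>real ^ 'd\<close>. The norm of \<^typ>\<open>real ^ 'd ^ 'd\<close> is the
  Euclidean norm of the entries, i.e. the Frobenius norm.\<close>

definition gradient :: "('a::euclidean_space \<Rightarrow> real) \<Rightarrow> 'a \<Rightarrow> 'a" where
  "gradient f x = (THE D. GDERIV f x :> D)"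

lemma gradient_eq:
  assumes "GDERIV f x :> D"
  shows "gradient f x = D"
  unfolding gradient_def
proof (rule the_equality)
  show "GDERIV f x :> D" by (rule assms)
next
  fix E assume "GDERIV f x :> E"
  then have "(\<lambda>k. k \<bullet> E) = (\<lambda>k. k \<bullet> D)"
    using assms unfolding gderiv_def by (rule has_derivative_unique)
  then have "\<forall>k. k \<bullet> E = k \<bullet> D" by meson
  then show "E = D" using inner_commute vector_eq_ldot by metis
qed

text \<open>The domain is finite-dimensional, so the derivative is of class \<open>C\<^sup>m\<close> as an operator-valued map
  if and only if it is of class \<open>C\<^sup>m\<close> after evaluation at every direction.\<close>

fun class_C :: "nat \<Rightarrow> ('a::euclidean_space \<Rightarrow> real) \<Rightarrow> bool" where
  "class_C 0 f \<longleftrightarrow> continuous_on UNIV f"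
| "class_C (Suc m) f \<longleftrightarrow>
     (\<forall>x. f differentiable (at x)) \<and> (\<forall>k. class_C m (\<lambda>x. frechet_derivative f (at x) k))"

text \<open>For \<open>f\<close> of class \<open>C\<^sup>m\<close>, \<open>deriv_along [k\<^sub>1, \<dots>, k\<^sub>m] f x\<close> is \<open>D\<^sup>m f(x).(k\<^sub>1, \<dots>, k\<^sub>m)\<close>.\<close>

primrec deriv_along :: "'a::euclidean_space list \<Rightarrow> ('a \<Rightarrow> real) \<Rightarrow> 'a \<Rightarrow> real" where
  "deriv_along [] f = f"
| "deriv_along (k # ks) f = deriv_along ks (\<lambda>x. frechet_derivative f (at x) k)"

definition deriv_quotients :: "nat \<Rightarrow> ('a::euclidean_space \<Rightarrow> real) \<Rightarrow> real set" where
  "deriv_quotients m f =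
     {\<bar>deriv_along ks f x\<bar> / prod_list (map norm ks) | x ks. length ks = m \<and> 0 \<notin> set ks}"

definition bounded_deriv :: "nat \<Rightarrow> ('a::euclidean_space \<Rightarrow> real) \<Rightarrow> bool" where
  "bounded_deriv m f \<longleftrightarrow> bdd_above (deriv_quotients m f)"

text \<open>Meaningful only when \<^term>\<open>bounded_deriv m f\<close>, because the supremum is taken in \<^typ>\<open>real\<close>.\<close>

definition deriv_norm :: "nat \<Rightarrow> ('a::euclidean_space \<Rightarrow> real) \<Rightarrow> real" where
  "deriv_norm m f = Sup (deriv_quotients m f)"

definition F_basic :: "(real ^ 'd \<Rightarrow> real) \<Rightarrow> bool" where
  "F_basic F \<longleftrightarrow>
     class_C 3 F \<and>
     (\<exists>L>0. \<forall>x1 x2. norm (gradient F x2 - gradient F x1) \<le> L * norm (x2 - x1)) \<and>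
     (\<exists>\<mu>>0. \<forall>x1 x2. (gradient F x2 - gradient F x1) \<bullet> (x2 - x1) \<ge> \<mu> * (norm (x2 - x1))\<^sup>2) \<and>
     bounded_deriv 3 F"

definition minimizer :: "(real ^ 'd \<Rightarrow> real) \<Rightarrow> real ^ 'd" where
  "minimizer F = (ARG_MIN F x. True)"

text \<open>The maps \<open>\<sigma>\<close> and \<open>s\<close> are constrained, and used, at nonnegative times only.\<close>

definition sigma_basic ::
  "(real ^ 'd \<Rightarrow> real) \<Rightarrow> (real \<Rightarrow> real ^ 'd \<Rightarrow> real ^ 'd ^ 'd) \<Rightarrow> bool" where
  "sigma_basic F \<sigma> \<longleftrightarrow>
     continuous_on ({0..} \<times> UNIV) (\<lambda>(t, x). \<sigma> t x) \<and>
     (\<exists>s :: real \<Rightarrow> real. bounded (s ` {0..}) \<and>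
        (\<forall>t\<ge>0. 0 \<le> s t \<and>
           (\<forall>x1 x2. norm (\<sigma> t x2 - \<sigma> t x1) \<le> s t * norm (x2 - x1)) \<and>
           (\<forall>x. norm (\<sigma> t x) / (1 + norm (x - minimizer F)) \<le> s t)))"

definition std_gaussian_density :: "real ^ 'd \<Rightarrow> real" where
  "std_gaussian_density x = exp (- (norm x)\<^sup>2 / 2) / sqrt (2 * pi) ^ CARD('d)"

lemma std_gaussian_density_prod:
  "std_gaussian_density (x :: real ^ 'd) = (\<Prod>i\<in>UNIV. std_normal_density (x $ i))"
proof -
  have "(norm x)\<^sup>2 = (\<Sum>i\<in>UNIV. (x $ i)\<^sup>2)"
    by (simp add: norm_vec_def L2_set_def sum_nonneg)
  then have "exp (- (norm x)\<^sup>2 / 2) = (\<Prod>i\<in>UNIV. exp (- (x $ i)\<^sup>2 / 2))"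
    by (simp add: exp_sum[symmetric] sum_negf sum_divide_distrib)
  then show ?thesis
    by (simp add: std_gaussian_density_def std_normal_density_def prod.distrib prod_dividef)
qed

definition iid_std_gaussian :: "'w measure \<Rightarrow> (nat \<Rightarrow> 'w \<Rightarrow> real ^ 'd) \<Rightarrow> bool" where
  "iid_std_gaussian M \<gamma> \<longleftrightarrow>
     prob_space.indep_vars M (\<lambda>_. borel) \<gamma> {1..} \<and>
     (\<forall>n\<ge>1. distributed M lborel (\<gamma> n) (\<lambda>x. ennreal (std_gaussian_density x)))"

primrec sg_scheme ::
  "(real ^ 'd \<Rightarrow> real) \<Rightarrow> (real \<Rightarrow> real ^ 'd \<Rightarrow> real ^ 'd ^ 'd) \<Rightarrow> (nat \<Rightarrow> 'w \<Rightarrow> real ^ 'd) \<Rightarrow>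
   real \<Rightarrow> real ^ 'd \<Rightarrow> nat \<Rightarrow> 'w \<Rightarrow> real ^ 'd" where
  "sg_scheme F \<sigma> \<gamma> h x0 0 = (\<lambda>\<omega>. x0)"
| "sg_scheme F \<sigma> \<gamma> h x0 (Suc n) = (\<lambda>\<omega>.
     sg_scheme F \<sigma> \<gamma> h x0 n \<omega>
     - h *\<^sub>R gradient F (sg_scheme F \<sigma> \<gamma> h x0 n \<omega>)
     + h *\<^sub>R (\<sigma> (real n * h) (sg_scheme F \<sigma> \<gamma> h x0 n \<omega>) *v \<gamma> (Suc n) \<omega>))"

definition gradient_system_solution ::
  "(real ^ 'd \<Rightarrow> real) \<Rightarrow> real ^ 'd \<Rightarrow> (real \<Rightarrow> real ^ 'd) \<Rightarrow> bool" where
  "gradient_system_solution F x0 \<X> \<longleftrightarrow>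
     \<X> 0 = x0 \<and>
     (\<forall>t\<ge>0. (\<X> has_vector_derivative - gradient F (\<X> t)) (at t within {0..}))"

end

theory Submission
  imports Defs
begin

text \<open>Write \<open>m\<^sub>n\<close> for the mean of \<open>X\<^sub>n\<close> and \<open>V\<^sub>n\<close> for its variance. For small \<open>h\<close> the gradient step
  \<open>x \<mapsto> x - h \<nabla>F(x)\<close> is a contraction of ratio \<open>1 - h \<mu> / 2\<close>, while the noise adds only \<open>O(h\<^sup>2)\<close> to the
  variance in each step; hence the second moments are bounded and \<open>V\<^sub>n = O(h)\<close>, uniformly in \<open>n\<close>.
  A function \<open>f\<close> with bounded second derivative satisfies \<open>E f(X\<^sub>n) = f(m\<^sub>n) + O(V\<^sub>n)\<close>, because the
  first-order term of the expansion at the mean has expectation zero. Applied to \<open>\<nabla>F\<close>, this shows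
  that \<open>m\<^sub>n\<close> follows the explicit Euler scheme of the gradient system up to errors \<open>O(h\<^sup>2)\<close> per step,
  which the contraction sums to \<open>O(h)\<close>; applied to \<open>\<phi>\<close>, it gives the weak error.\<close>

section \<open>Mean value and Taylor estimates for functions with bounded second derivative\<close>

lemma mvt_segment:
  fixes f :: "'a::real_normed_vector \<Rightarrow> real"
  assumes "\<And>z. f differentiable (at z)"
  obtains t where "0 < t" "t < 1"
    "f y - f x = frechet_derivative f (at (x + t *\<^sub>R (y - x))) (y - x)"
proof -
  let ?g = "\<lambda>t. f (x + t *\<^sub>R (y - x))"
  have "(?g has_derivative (\<lambda>s. frechet_derivative f (at (x + t *\<^sub>R (y - x))) (s *\<^sub>R (y - x))))
      (at t within {0..1})" for t
  proof (rule has_derivative_at_withinI, rule has_derivative_compose[where g = f])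
    show "((\<lambda>t. x + t *\<^sub>R (y - x)) has_derivative (\<lambda>s. s *\<^sub>R (y - x))) (at t)"
      by (auto intro!: derivative_eq_intros)
    show "(f has_derivative frechet_derivative f (at (x + t *\<^sub>R (y - x)))) (at (x + t *\<^sub>R (y - x)))"
      using assms frechet_derivative_works by blast
  qed
  then have "\<exists>t\<in>{0<..<1}. ?g 1 - ?g 0
      = frechet_derivative f (at (x + t *\<^sub>R (y - x))) ((1 - 0) *\<^sub>R (y - x))"
    by (intro mvt_simple) auto
  then show thesis
    using that by auto
qed

text \<open>\<open>gradient\<close> is a definite description, so a witness has to be supplied: the
  vector of partial derivatives along the basis represents the derivative by linearity.\<close>

lemma GDERIV_gradient:
  assumes "f differentiable (at x)"
  shows "GDERIV f x :> gradient f x"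
proof -
  let ?D = "\<Sum>b\<in>Basis. frechet_derivative f (at x) b *\<^sub>R b"
  have f': "(f has_derivative frechet_derivative f (at x)) (at x)"
    using assms frechet_derivative_works by blast
  have "frechet_derivative f (at x) k = k \<bullet> ?D" for k
  proof -
    interpret linear "frechet_derivative f (at x)"
      using f' has_derivative_linear by blast
    have "frechet_derivative f (at x) (\<Sum>b\<in>Basis. (k \<bullet> b) *\<^sub>R b)
        = (\<Sum>b\<in>Basis. (k \<bullet> b) * frechet_derivative f (at x) b)"
      by (simp add: sum scale)
    then show ?thesis
      by (simp add: euclidean_representation inner_sum_right mult.commute)
  qed
  then have "frechet_derivative f (at x) = (\<lambda>k. k \<bullet> ?D)"
    by blast
  then have "GDERIV f x :> ?D"
    using f' unfolding gderiv_def by simp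
  then show ?thesis
    using gradient_eq by metis
qed

lemma frechet_derivative_gradient:
  assumes "f differentiable (at x)"
  shows "frechet_derivative f (at x) k = k \<bullet> gradient f x"
  using GDERIV_gradient[OF assms] frechet_derivative_at unfolding gderiv_def by metis

lemma class_C_continuous: "class_C m f \<Longrightarrow> continuous_on UNIV f"
  by (cases m) (auto simp: differentiable_imp_continuous_within continuous_at_imp_continuous_on)

lemma bounded_derivD:
  assumes "bounded_deriv m f" "length ks = m" "0 \<notin> set ks"
  shows "\<bar>deriv_along ks f x\<bar> \<le> deriv_norm m f * prod_list (map norm ks)"
proof -
  have "\<bar>deriv_along ks f x\<bar> / prod_list (map norm ks) \<in> deriv_quotients m f"
    unfolding deriv_quotients_def using assms by blast
  then have "\<bar>deriv_along ks f x\<bar> / prod_list (map norm ks) \<le> deriv_norm m f"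
    unfolding deriv_norm_def using assms(1) cSup_upper unfolding bounded_deriv_def by blast
  moreover have "0 < prod_list (map norm ks)"
    using assms(3) by (induction ks) auto
  ultimately show ?thesis
    by (simp add: divide_simps)
qed

text \<open>With a unit vector in every slot, the bound of \<open>bounded_derivD\<close> is
  \<open>deriv_norm m f\<close> itself, and it dominates an absolute value.\<close>

lemma deriv_norm_nonneg:
  fixes f :: "'a::euclidean_space \<Rightarrow> real"
  assumes "bounded_deriv m f"
  shows "0 \<le> deriv_norm m f"
proof -
  obtain b :: 'a where b: "b \<in> Basis"
    using nonempty_Basis by blast
  have "\<bar>deriv_along (replicate m b) f 0\<bar> \<le> deriv_norm m f * prod_list (map norm (replicate m b))"
    using assms b nonzero_Basis[of b] by (intro bounded_derivD) auto
  then show ?thesis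
    using b by (simp add: prod_list_replicate)
qed

text \<open>Mean value theorem for the scalar function
  \<open>\<lambda>x. frechet_derivative f (at x) k\<close>, whose derivative in direction
  \<open>y - x\<close> is the second derivative along \<open>[k, y - x]\<close>.\<close>

lemma frechet_derivative_lipschitz:
  assumes C: "class_C 2 f"
    and B: "\<And>x k l. k \<noteq> 0 \<Longrightarrow> l \<noteq> 0 \<Longrightarrow> \<bar>deriv_along [k, l] f x\<bar> \<le> B * (norm k * norm l)"
  shows "\<bar>frechet_derivative f (at y) k - frechet_derivative f (at x) k\<bar> \<le> B * (norm k * norm (y - x))"
\<comment> \<open>The bound \<open>B\<close> speaks of nonzero directions only, so the degenerate
  cases are settled by linearity.\<close>
proof (cases "k = 0 \<or> y = x")
  case True
  have "linear (frechet_derivative f (at z))" for z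
    using C frechet_derivative_works has_derivative_linear unfolding numeral_2_eq_2 class_C.simps by blast
  then show ?thesis
    using True by (auto simp: linear_0)
next
  case False
  have "(\<lambda>x. frechet_derivative f (at x) k) differentiable (at z)" for z
    using C by (simp add: numeral_2_eq_2)
  then obtain t where "frechet_derivative f (at y) k - frechet_derivative f (at x) k
      = deriv_along [k, y - x] f (x + t *\<^sub>R (y - x))"
    by (rule mvt_segment[where x = x and y = y]) simp
  then show ?thesis
    using B[of k "y - x" "x + t *\<^sub>R (y - x)"] False by simp
qed

text \<open>The increment is the derivative at an intermediate point, compared with the derivative
  at \<open>x\<close> by its Lipschitz bound. This route gives the constant \<open>B\<close> instead
  of \<open>B / 2\<close>, which only affects the final constant.\<close>

lemma taylor_first_order:
  assumes C: "class_C 2 f" and "0 \<le> B"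
    and B: "\<And>x k l. k \<noteq> 0 \<Longrightarrow> l \<noteq> 0 \<Longrightarrow> \<bar>deriv_along [k, l] f x\<bar> \<le> B * (norm k * norm l)"
  shows "\<bar>f y - f x - (y - x) \<bullet> gradient f x\<bar> \<le> B * (norm (y - x))\<^sup>2"
proof -
  have diff: "f differentiable (at z)" for z
    using C by (simp add: numeral_2_eq_2)
  obtain t where t: "0 < t" "t < 1"
    and eq: "f y - f x = frechet_derivative f (at (x + t *\<^sub>R (y - x))) (y - x)"
    using mvt_segment[OF diff] by blast
  have "\<bar>f y - f x - (y - x) \<bullet> gradient f x\<bar> \<le> B * (norm (y - x) * norm (t *\<^sub>R (y - x)))"
    using frechet_derivative_lipschitz[OF C B, of "x + t *\<^sub>R (y - x)" "y - x" x]
    by (simp add: eq frechet_derivative_gradient[OF diff])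
  also have "\<dots> \<le> B * (norm (y - x) * norm (y - x))"
    using t \<open>0 \<le> B\<close> by (intro mult_left_mono) (auto intro: mult_left_le_one_le)
  finally show ?thesis
    by (simp add: power2_eq_square)
qed

text \<open>Away from \<open>z\<close> the gradient grows at most linearly, which makes
  \<open>f\<close> Lipschitz on the ball of radius \<open>r\<close> around \<open>z\<close>. With
  \<open>z\<close> the minimizer of the objective, this is how the gradient of the test function at
  that single point enters the estimate.\<close>

lemma increment_bound:
  assumes C: "class_C 2 f"
    and B: "\<And>x k l. k \<noteq> 0 \<Longrightarrow> l \<noteq> 0 \<Longrightarrow> \<bar>deriv_along [k, l] f x\<bar> \<le> B * (norm k * norm l)"
    and "0 \<le> B" "norm (x - z) \<le> r" "norm (y - z) \<le> r"
  shows "\<bar>f y - f x\<bar> \<le> (norm (gradient f z) + B * r) * norm (y - x)"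
proof -
  have diff: "f differentiable (at z)" for z
    using C by (simp add: numeral_2_eq_2)
  obtain t where t: "0 < t" "t < 1"
    and eq: "f y - f x = frechet_derivative f (at (x + t *\<^sub>R (y - x))) (y - x)"
    using mvt_segment[OF diff] by blast
  define \<xi> where "\<xi> = x + t *\<^sub>R (y - x)"
  \<comment> \<open>Convexity of the ball keeps the intermediate point within distance
    \<open>r\<close> of \<open>z\<close>.\<close>
  have "x \<in> cball z r" "y \<in> cball z r"
    using assms by (auto simp: dist_norm norm_minus_commute)
  then have "(1 - t) *\<^sub>R x + t *\<^sub>R y \<in> cball z r"
    using t by (intro convexD) auto
  then have \<xi>: "norm (\<xi> - z) \<le> r"
    by (simp add: dist_norm norm_minus_commute \<xi>_def algebra_simps)
  have "\<bar>f y - f x - (y - x) \<bullet> gradient f z\<bar> \<le> B * (norm (y - x) * norm (\<xi> - z))"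
    using frechet_derivative_lipschitz[OF C B, of \<xi> "y - x" z]
    by (simp add: eq frechet_derivative_gradient[OF diff] \<xi>_def)
  also have "\<dots> \<le> B * (norm (y - x) * r)"
    using \<xi> \<open>0 \<le> B\<close> by (intro mult_left_mono) auto
  finally have "\<bar>f y - f x\<bar> \<le> \<bar>(y - x) \<bullet> gradient f z\<bar> + B * (norm (y - x) * r)"
    by linarith
  also have "\<bar>(y - x) \<bullet> gradient f z\<bar> \<le> norm (y - x) * norm (gradient f z)"
    by (rule Cauchy_Schwarz_ineq2)
  finally show ?thesis
    by (simp add: algebra_simps)
qed

section \<open>Contraction of the gradient step, and the minimizer\<close>

lemma gradient_step_contraction:
  fixes G :: "'a::real_inner \<Rightarrow> 'a"
  assumes L: "\<And>x y. norm (G y - G x) \<le> L * norm (y - x)"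
    and \<mu>: "\<And>x y. \<mu> * (norm (y - x))\<^sup>2 \<le> (G y - G x) \<bullet> (y - x)"
    and "0 < L" "0 \<le> h" "h * L\<^sup>2 \<le> \<mu>"
  shows "(norm ((y - h *\<^sub>R G y) - (x - h *\<^sub>R G x)))\<^sup>2 \<le> (1 - h * \<mu>) * (norm (y - x))\<^sup>2"
proof -
  define d where "d = y - x"
  define g where "g = G y - G x"
  have eq: "(y - h *\<^sub>R G y) - (x - h *\<^sub>R G x) = d - h *\<^sub>R g"
    by (simp add: d_def g_def algebra_simps)
  \<comment> \<open>The cross term lowers the square by at least
    \<open>2 * h * \<mu> * (norm d)\<^sup>2\<close>; the quadratic term gives back at most half of
    this because \<open>h * L\<^sup>2 \<le> \<mu>\<close>.\<close>
  have "(norm (d - h *\<^sub>R g))\<^sup>2 = (norm d)\<^sup>2 - 2 * h * (g \<bullet> d) + h * h * (norm g)\<^sup>2"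
    by (simp add: power2_norm_eq_inner inner_diff_left inner_diff_right inner_commute algebra_simps)
  moreover have "h * (\<mu> * (norm d)\<^sup>2) \<le> h * (g \<bullet> d)"
    using \<mu> \<open>0 \<le> h\<close> by (intro mult_left_mono) (auto simp: d_def g_def)
  moreover have "h * (h * (norm g)\<^sup>2) \<le> h * (\<mu> * (norm d)\<^sup>2)"
  proof (rule mult_left_mono[OF _ \<open>0 \<le> h\<close>])
    have "(norm g)\<^sup>2 \<le> (L * norm d)\<^sup>2"
      using L by (intro power_mono) (auto simp: d_def g_def)
    then have "h * (norm g)\<^sup>2 \<le> h * (L * norm d)\<^sup>2"
      using \<open>0 \<le> h\<close> by (rule mult_left_mono)
    also have "\<dots> = (h * L\<^sup>2) * (norm d)\<^sup>2"
      by (simp add: power_mult_distrib)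
    also have "\<dots> \<le> \<mu> * (norm d)\<^sup>2"
      using assms by (intro mult_right_mono) auto
    finally show "h * (norm g)\<^sup>2 \<le> \<mu> * (norm d)\<^sup>2" .
  qed
  ultimately show ?thesis
    unfolding eq d_def[symmetric] by (simp add: algebra_simps)
qed

text \<open>The factor \<open>1 - h * \<mu>\<close> for squares is at most
  \<open>(1 - h * \<mu> / 2)\<^sup>2\<close>; the condition \<open>h * \<mu> \<le> 1\<close> keeps
  the root nonnegative.\<close>

lemma gradient_step_contraction_norm:
  fixes G :: "'a::real_inner \<Rightarrow> 'a"
  assumes "\<And>x y. norm (G y - G x) \<le> L * norm (y - x)"
    and "\<And>x y. \<mu> * (norm (y - x))\<^sup>2 \<le> (G y - G x) \<bullet> (y - x)"
    and "0 < L" "0 \<le> h" "h * L\<^sup>2 \<le> \<mu>" "h * \<mu> \<le> 1"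
  shows "norm ((y - h *\<^sub>R G y) - (x - h *\<^sub>R G x)) \<le> (1 - h * \<mu> / 2) * norm (y - x)"
proof (rule power2_le_imp_le)
  have "1 - h * \<mu> \<le> (1 - h * \<mu> / 2)\<^sup>2"
    using zero_le_square[of "h * \<mu> / 2"] by (simp add: power2_eq_square algebra_simps)
  then have "(1 - h * \<mu>) * (norm (y - x))\<^sup>2 \<le> (1 - h * \<mu> / 2)\<^sup>2 * (norm (y - x))\<^sup>2"
    by (rule mult_right_mono) simp
  then show "(norm ((y - h *\<^sub>R G y) - (x - h *\<^sub>R G x)))\<^sup>2 \<le> ((1 - h * \<mu> / 2) * norm (y - x))\<^sup>2"
    using gradient_step_contraction[OF assms(1-5), of y x] by (simp add: power_mult_distrib)
  show "0 \<le> (1 - h * \<mu> / 2) * norm (y - x)"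
    using assms by simp
qed

text \<open>A zero of the gradient is found as the fixed point of the contraction
  \<open>x \<mapsto> x - h \<nabla>F(x)\<close> for small \<open>h\<close>.\<close>

lemma strongly_monotone_zero:
  fixes G :: "'a::euclidean_space \<Rightarrow> 'a"
  assumes L: "\<And>x y. norm (G y - G x) \<le> L * norm (y - x)"
    and \<mu>: "\<And>x y. \<mu> * (norm (y - x))\<^sup>2 \<le> (G y - G x) \<bullet> (y - x)"
    and "0 < L" "0 < \<mu>"
  obtains z where "G z = 0"
proof -
  define h where "h = min (\<mu> / L\<^sup>2) (1 / \<mu>)"
  have h: "0 < h" "h * L\<^sup>2 \<le> \<mu>" "h * \<mu> \<le> 1"
    using assms by (auto simp: h_def min_def field_simps)
  have "dist (y - h *\<^sub>R G y) (x - h *\<^sub>R G x) \<le> (1 - h * \<mu> / 2) * dist y x" for x y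
    using gradient_step_contraction_norm[OF L \<mu> \<open>0 < L\<close>] h by (simp add: dist_norm)
  moreover have "0 \<le> 1 - h * \<mu> / 2" "1 - h * \<mu> / 2 < 1"
    using h \<open>0 < \<mu>\<close> by auto
  ultimately have "\<exists>!z. z - h *\<^sub>R G z = z"
    by (intro banach_fix_type[of "1 - h * \<mu> / 2"]) auto
  then show thesis
    using that h by auto
qed

text \<open>\<open>minimizer F\<close> is an arbitrary choice unless a minimizer exists.
  Monotonicity along segments from a zero of the gradient shows that this zero is a global minimum;
  hence the chosen point is a genuine minimizer and therefore critical.\<close>

lemma gradient_minimizer:
  assumes diff: "\<And>x. F differentiable (at x)"
    and L: "\<And>x y. norm (gradient F y - gradient F x) \<le> L * norm (y - x)"
    and \<mu>: "\<And>x y. \<mu> * (norm (y - x))\<^sup>2 \<le> (gradient F y - gradient F x) \<bullet> (y - x)"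
    and "0 < L" "0 < \<mu>"
  shows "gradient F (minimizer F) = 0"
proof -
  obtain z where z: "gradient F z = 0"
    using strongly_monotone_zero[OF L \<mu> \<open>0 < L\<close> \<open>0 < \<mu>\<close>] .
  have "F z \<le> F y" for y
  proof -
    obtain t where t: "0 < t"
      and eq: "F y - F z = frechet_derivative F (at (z + t *\<^sub>R (y - z))) (y - z)"
      using mvt_segment[OF diff] by blast
    have "0 \<le> \<mu> * (norm (t *\<^sub>R (y - z)))\<^sup>2"
      using \<open>0 < \<mu>\<close> by simp
    also have "\<dots> \<le> t * (gradient F (z + t *\<^sub>R (y - z)) \<bullet> (y - z))"
      using \<mu>[of "z + t *\<^sub>R (y - z)" z] by (simp add: z)
    finally show ?thesis
      using t eq by (simp add: frechet_derivative_gradient[OF diff] inner_commute zero_le_mult_iff)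
  qed
  then have "is_arg_min F (\<lambda>_. True) z"
    by (simp add: is_arg_min_linorder)
  then have "is_arg_min F (\<lambda>_. True) (minimizer F)"
    unfolding minimizer_def arg_min_def by (rule someI)
  then have "F (minimizer F) \<le> F y" for y
    by (simp add: is_arg_min_linorder)
  moreover have "(F has_derivative (\<lambda>k. k \<bullet> gradient F (minimizer F))) (at (minimizer F))"
    using GDERIV_gradient[OF diff] by (simp add: gderiv_def)
  ultimately have "(\<lambda>k. k \<bullet> gradient F (minimizer F)) = (\<lambda>k. 0)"
    by (intro differential_zero_maxmin[of _ UNIV]) auto
  then show ?thesis
    by (metis inner_eq_zero_iff)
qed

section \<open>The gradient system\<close>

text \<open>The squared distance to \<open>z\<close> has derivative
  \<open>- 2 * (gradient F (\<X> s) \<bullet> (\<X> s - z))\<close>, which is nonpositive by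
  monotonicity since the gradient vanishes at \<open>z\<close>.\<close>

lemma gradient_system_norm_le:
  assumes sol: "gradient_system_solution F x0 \<X>"
    and mono: "\<And>x y. 0 \<le> (gradient F y - gradient F x) \<bullet> (y - x)"
    and z: "gradient F z = 0" and "0 \<le> t"
  shows "norm (\<X> t - z) \<le> norm (x0 - z)"
proof -
  let ?u = "\<lambda>t. (norm (\<X> t - z))\<^sup>2"
  have deriv: "(\<X> has_derivative (\<lambda>s. s *\<^sub>R - gradient F (\<X> t))) (at t within {0..})" if "0 \<le> t" for t
    using sol that unfolding gradient_system_solution_def has_vector_derivative_def by blast
  have "(?u has_real_derivative - 2 * (gradient F (\<X> s) \<bullet> (\<X> s - z))) (at s within {0..})"
    if "0 \<le> s" for s
    unfolding power2_norm_eq_inner has_field_derivative_def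
    by (rule derivative_eq_intros deriv that | simp)+ (auto simp: fun_eq_iff inner_commute algebra_simps)
  then have d: "\<And>s. 0 \<le> s \<Longrightarrow> (?u has_real_derivative - 2 * (gradient F (\<X> s) \<bullet> (\<X> s - z))) (at s within {0..t})"
    by (rule has_field_derivative_subset) auto
  have "?u t \<le> ?u 0"
  proof (cases "t = 0")
    case False
    then have "\<exists>s\<in>{0<..<t}. ?u t - ?u 0 = - 2 * (gradient F (\<X> s) \<bullet> (\<X> s - z)) * (t - 0)"
      using \<open>0 \<le> t\<close> d unfolding has_field_derivative_def
      by (intro mvt_simple[where f' = "\<lambda>s. (*) (- 2 * (gradient F (\<X> s) \<bullet> (\<X> s - z)))"]) auto
    then obtain s where "?u t - ?u 0 = - 2 * (gradient F (\<X> s) \<bullet> (\<X> s - z)) * t"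
      by auto
    moreover have "0 \<le> (gradient F (\<X> s) \<bullet> (\<X> s - z)) * t"
      using mono[of "\<X> s" z] z \<open>0 \<le> t\<close> by simp
    ultimately show ?thesis
      by linarith
  qed simp
  then show ?thesis
    using sol by (simp add: gradient_system_solution_def)
qed

text \<open>This is the error of one explicit Euler step started on the solution. The Lipschitz
  bound is used twice: the speed is at most \<open>L * norm (x0 - z)\<close> because the solution
  never moves away from \<open>z\<close>, so over time \<open>h\<close> the velocity changes by at
  most \<open>L * (L * norm (x0 - z) * h)\<close>.\<close>

lemma gradient_system_local_error:
  assumes sol: "gradient_system_solution F x0 \<X>"
    and L: "\<And>x y. norm (gradient F y - gradient F x) \<le> L * norm (y - x)" and "0 \<le> L"
    and mono: "\<And>x y. 0 \<le> (gradient F y - gradient F x) \<bullet> (y - x)"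
    and z: "gradient F z = 0" and "0 \<le> t" "0 \<le> h"
  shows "norm (\<X> (t + h) - (\<X> t - h *\<^sub>R gradient F (\<X> t))) \<le> h\<^sup>2 * L\<^sup>2 * norm (x0 - z)"
proof -
  let ?R = "norm (x0 - z)"
  have deriv: "(\<X> has_vector_derivative - gradient F (\<X> s)) (at s within {t..t + h})"
    if "s \<in> {t..t + h}" for s
  proof (rule has_vector_derivative_within_subset)
    show "(\<X> has_vector_derivative - gradient F (\<X> s)) (at s within {0..})"
      using sol that \<open>0 \<le> t\<close> unfolding gradient_system_solution_def by simp
  qed (use \<open>0 \<le> t\<close> in auto)
  have "norm (- gradient F (\<X> s)) \<le> L * ?R" if "s \<in> {t..t + h}" for s
  proof -
    have "norm (- gradient F (\<X> s)) \<le> L * norm (\<X> s - z)"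
      using L[of "\<X> s" z] z by simp
    also have "\<dots> \<le> L * ?R"
      using gradient_system_norm_le[OF sol mono z] that assms by (intro mult_left_mono) auto
    finally show ?thesis .
  qed
  then have "onorm (\<lambda>k. k *\<^sub>R - gradient F (\<X> s)) \<le> L * ?R" if "s \<in> {t..t + h}" for s
    using that \<open>0 \<le> L\<close> by (intro onorm_bound) (auto simp: mult.commute[of "L * ?R"] intro: mult_left_mono)
  then have dist: "norm (\<X> s - \<X> t) \<le> L * ?R * norm (s - t)" if "s \<in> {t..t + h}" for s
    using deriv that \<open>0 \<le> h\<close> unfolding has_vector_derivative_def
    by (intro differentiable_bound[where f' = "\<lambda>s k. k *\<^sub>R - gradient F (\<X> s)" and S = "{t..t + h}"]) auto
  have "norm (- gradient F (\<X> s) - - gradient F (\<X> t)) \<le> L * (L * ?R * h)" if "s \<in> {t..t + h}" for s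
  proof -
    have "norm (- gradient F (\<X> s) - - gradient F (\<X> t)) \<le> L * norm (\<X> s - \<X> t)"
      using L[of "\<X> s" "\<X> t"] by (simp add: norm_minus_commute)
    also have "\<dots> \<le> L * (L * ?R * norm (s - t))"
      using dist[OF that] \<open>0 \<le> L\<close> by (rule mult_left_mono)
    also have "\<dots> \<le> L * (L * ?R * h)"
      using that \<open>0 \<le> L\<close> by (intro mult_left_mono) auto
    finally show ?thesis .
  qed
  then have "norm (\<X> (t + h) - \<X> t - (t + h - t) *\<^sub>R - gradient F (\<X> t))
      \<le> norm (t + h - t) * (L * (L * ?R * h))"
    using deriv \<open>0 \<le> h\<close>
    by (intro vector_differentiable_bound_linearization[where S = "{t..t + h}"])
      (auto simp: closed_segment_eq_real_ivl)
  then show ?thesis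
    using \<open>0 \<le> h\<close> by (simp add: algebra_simps power2_eq_square)
qed

section \<open>Gaussian moments\<close>

lemma Basis_vec_real: "(Basis :: (real ^ 'd) set) = range (\<lambda>i. axis i 1)"
  by (auto simp: Basis_vec_def)

lemma prod_Basis_vec:
  "(\<Prod>b\<in>(Basis :: (real ^ 'd) set). f b) = (\<Prod>i\<in>UNIV. f (axis i 1))"
proof -
  have "inj (\<lambda>i. axis i 1 :: real ^ 'd)"
    by (auto simp: inj_def axis_eq_axis)
  then show ?thesis
    unfolding Basis_vec_real by (simp add: prod.reindex)
qed

lemma std_gaussian_density_nonneg: "0 \<le> std_gaussian_density x"
  by (simp add: std_gaussian_density_def)

lemma continuous_on_std_gaussian_density: "continuous_on A std_gaussian_density"
  unfolding std_gaussian_density_def by (intro continuous_intros) auto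

lemma borel_measurable_std_gaussian_density [measurable]:
  "std_gaussian_density \<in> borel_measurable borel"
  by (intro borel_measurable_continuous_onI continuous_on_std_gaussian_density)

text \<open>The density is a product over the coordinates, so the integral factorizes into
  one-dimensional Gaussian integrals: a second moment for coordinate \<open>j\<close> and total
  masses for the others.\<close>

lemma integrable_std_gaussian_component_square:
  "integrable lborel (\<lambda>x :: real ^ 'd. std_gaussian_density x * (x $ j)\<^sup>2)"
proof (rule integrableI_bounded)
  define f where "f b y = std_normal_density y * (if b = axis j 1 then y\<^sup>2 else 1)"
    for b :: "real ^ 'd" and y
  have int: "integrable lborel (f b)" for b
    using integrable_std_normal_moment[of 2] integrable_std_normal_moment[of 0]
    by (cases "b = axis j 1") (simp_all add: f_def[abs_def])
  have nonneg: "0 \<le> f b y" for b y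
    by (simp add: f_def)
  have "ennreal (norm (std_gaussian_density x * (x $ j)\<^sup>2)) = (\<Prod>b\<in>Basis. ennreal (f b (x \<bullet> b)))"
    for x :: "real ^ 'd"
  proof -
    have "std_gaussian_density x * (x $ j)\<^sup>2 = (\<Prod>i\<in>UNIV. f (axis i 1) (x $ i))"
      by (simp add: f_def std_gaussian_density_prod prod.distrib axis_eq_axis)
    then show ?thesis
      by (simp add: prod_Basis_vec prod_ennreal nonneg inner_axis prod_nonneg)
  qed
  then have "(\<integral>\<^sup>+x. norm (std_gaussian_density x * (x $ j)\<^sup>2) \<partial>(lborel :: (real ^ 'd) measure))
      = (\<Prod>b\<in>(Basis :: (real ^ 'd) set). \<integral>\<^sup>+y. ennreal (f b y) \<partial>lborel)"
    by (simp only:) (intro nn_integral_lborel_prod, auto simp: f_def)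
  also have "\<dots> = (\<Prod>b\<in>(Basis :: (real ^ 'd) set). ennreal (\<integral>y. f b y \<partial>lborel))"
    using int nonneg by (intro prod.cong nn_integral_eq_integral) auto
  also have "\<dots> < \<infinity>"
    using nonneg by (simp add: prod_ennreal)
  finally show "(\<integral>\<^sup>+x. norm (std_gaussian_density x * (x $ j)\<^sup>2) \<partial>(lborel :: (real ^ 'd) measure)) < \<infinity>" .
qed simp

lemma norm_vec_square: "(norm (x :: real ^ 'd))\<^sup>2 = (\<Sum>i\<in>UNIV. (x $ i)\<^sup>2)"
  by (simp add: norm_vec_def L2_set_def sum_nonneg)

lemma integrable_std_gaussian_norm_square:
  "integrable lborel (\<lambda>x :: real ^ 'd. std_gaussian_density x * (norm x)\<^sup>2)"
  unfolding norm_vec_square sum_distrib_left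
  by (intro Bochner_Integration.integrable_sum integrable_std_gaussian_component_square)

lemma integral_lborel_reflect:
  fixes f :: "'a::euclidean_space \<Rightarrow> real"
  assumes [measurable]: "f \<in> borel_measurable borel"
  shows "(\<integral>x. f (- x) \<partial>lborel) = (\<integral>x. f x \<partial>lborel)"
proof -
  have "(lborel :: 'a measure) = distr lborel borel (\<lambda>x. - x)"
    using lborel_affine[of "- 1" "0 :: 'a"] by (simp add: density_1)
  then have "(\<integral>x. f x \<partial>lborel) = (\<integral>x. f x \<partial>distr lborel borel (\<lambda>x. - x))"
    by simp
  then show ?thesis
    by (simp add: integral_distr)
qed

text \<open>The density is even, so the integrand is odd and reflection turns the integral into its
  negative.\<close>

lemma integral_std_gaussian_component:
  "(\<integral>x. std_gaussian_density x * x $ j \<partial>lborel) = 0"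
  using integral_lborel_reflect[of "\<lambda>x. std_gaussian_density x * x $ j"]
  by (simp add: std_gaussian_density_def)

text \<open>These are the facts on the Gaussian law that the locale \<open>sg_fixed_step\<close>
  takes as assumptions; the second moment is a fixed integral, hence the same for every noise
  vector.\<close>

lemma distributed_std_gaussian_moments:
  fixes Z :: "'w \<Rightarrow> real ^ 'd"
  assumes D: "distributed M lborel Z (\<lambda>x. ennreal (std_gaussian_density x))"
  shows "integrable M (\<lambda>\<omega>. (norm (Z \<omega>))\<^sup>2)"
    and "(\<integral>\<omega>. (norm (Z \<omega>))\<^sup>2 \<partial>M) = (\<integral>x. std_gaussian_density x * (norm x)\<^sup>2 \<partial>(lborel :: (real ^ 'd) measure))"
    and "(\<integral>\<omega>. Z \<omega> $ j \<partial>M) = 0"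
proof -
  show "integrable M (\<lambda>\<omega>. (norm (Z \<omega>))\<^sup>2)"
    by (subst distributed_integrable[OF D, of "\<lambda>x. (norm x)\<^sup>2", symmetric])
      (simp_all add: std_gaussian_density_nonneg integrable_std_gaussian_norm_square)
  show "(\<integral>\<omega>. (norm (Z \<omega>))\<^sup>2 \<partial>M) = (\<integral>x. std_gaussian_density x * (norm x)\<^sup>2 \<partial>(lborel :: (real ^ 'd) measure))"
    by (subst distributed_integral[OF D, of "\<lambda>x. (norm x)\<^sup>2", symmetric])
      (simp_all add: std_gaussian_density_nonneg)
  show "(\<integral>\<omega>. Z \<omega> $ j \<partial>M) = 0"
    using distributed_integral[OF D, of "\<lambda>x. x $ j"] integral_std_gaussian_component[of j]
    by (simp add: std_gaussian_density_nonneg)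
qed

section \<open>Square-integrable random vectors\<close>

text \<open>Cauchy-Schwarz in each row; the Frobenius norm dominates the operator norm.\<close>

lemma norm_matrix_vector_mult_le: "norm (A *v x) \<le> norm A * norm (x :: real ^ 'd)"
  for A :: "real ^ 'd ^ 'n"
proof (rule power2_le_imp_le)
  have "(norm (A *v x))\<^sup>2 = (\<Sum>i\<in>UNIV. (A $ i \<bullet> x)\<^sup>2)"
    by (simp add: norm_vec_square matrix_vector_mul_component)
  also have "\<dots> \<le> (\<Sum>i\<in>UNIV. (norm (A $ i))\<^sup>2 * (norm x)\<^sup>2)"
    using Cauchy_Schwarz_ineq by (intro sum_mono) (simp add: power2_norm_eq_inner)
  also have "\<dots> = (norm A * norm x)\<^sup>2"
    by (simp add: norm_vec_def[of A] L2_set_def sum_nonneg power_mult_distrib sum_distrib_right)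
  finally show "(norm (A *v x))\<^sup>2 \<le> (norm A * norm x)\<^sup>2" .
qed simp

context prob_space
begin

definition square_integrable :: "('a \<Rightarrow> 'b::euclidean_space) \<Rightarrow> bool" where
  "square_integrable X \<longleftrightarrow> X \<in> borel_measurable M \<and> integrable M (\<lambda>\<omega>. (norm (X \<omega>))\<^sup>2)"

text \<open>Needed to carry square integrability through the gradient step and the diffusion
  coefficient, both of linear growth.\<close>

lemma square_integrable_linear_growth:
  assumes X: "square_integrable X" and [measurable]: "f \<in> borel_measurable borel"
    and f: "\<And>x. norm (f x) \<le> a + b * norm x"
  shows "square_integrable (\<lambda>\<omega>. f (X \<omega>))"
proof -
  have [measurable]: "X \<in> borel_measurable M" and "integrable M (\<lambda>\<omega>. (norm (X \<omega>))\<^sup>2)"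
    using X by (auto simp: square_integrable_def)
  then have int: "integrable M (\<lambda>\<omega>. 2 * a\<^sup>2 + 2 * b\<^sup>2 * (norm (X \<omega>))\<^sup>2)"
    by simp
  have "(norm (f x))\<^sup>2 \<le> 2 * a\<^sup>2 + 2 * b\<^sup>2 * (norm x)\<^sup>2" for x
  proof -
    have "(norm (f x))\<^sup>2 \<le> (a + b * norm x)\<^sup>2"
      using f by (intro power_mono) auto
    also have "\<dots> \<le> 2 * a\<^sup>2 + 2 * b\<^sup>2 * (norm x)\<^sup>2"
      using zero_le_power2[of "a - b * norm x"] by (simp add: power2_eq_square algebra_simps)
    finally show ?thesis .
  qed
  then have "norm ((norm (f (X \<omega>)))\<^sup>2) \<le> norm (2 * a\<^sup>2 + 2 * b\<^sup>2 * (norm (X \<omega>))\<^sup>2)" for \<omega>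
    by simp
  then have "integrable M (\<lambda>\<omega>. (norm (f (X \<omega>)))\<^sup>2)"
    by (intro Bochner_Integration.integrable_bound[OF int] AE_I2) measurable
  then show ?thesis
    by (simp add: square_integrable_def)
qed

lemma square_integrable_diff_const:
  "square_integrable X \<Longrightarrow> square_integrable (\<lambda>\<omega>. X \<omega> - c)"
  using norm_triangle_ineq4[of _ c]
  by (intro square_integrable_linear_growth[of X "\<lambda>x. x - c" "norm c" 1]) (auto simp: add.commute)

lemma square_integrable_imp_integrable:
  assumes "square_integrable X"
  shows "integrable M X"
proof (rule Bochner_Integration.integrable_bound)
  show "integrable M (\<lambda>\<omega>. 1 + (norm (X \<omega>))\<^sup>2)"
    using assms by (simp add: square_integrable_def)
  have "norm x \<le> 1 + (norm x)\<^sup>2" for x :: 'b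
    using zero_le_power2[of "norm x - 1"] norm_ge_zero[of x]
    unfolding power2_diff power_one by linarith
  then show "AE \<omega> in M. norm (X \<omega>) \<le> norm (1 + (norm (X \<omega>))\<^sup>2)"
    by simp
qed (use assms in \<open>simp add: square_integrable_def\<close>)

lemma integrable_inner_square_integrable:
  assumes "square_integrable X" "square_integrable Y"
  shows "integrable M (\<lambda>\<omega>. X \<omega> \<bullet> Y \<omega>)"
proof (rule Bochner_Integration.integrable_bound)
  show "integrable M (\<lambda>\<omega>. (norm (X \<omega>))\<^sup>2 + (norm (Y \<omega>))\<^sup>2)"
    using assms by (simp add: square_integrable_def)
  have "\<bar>x \<bullet> y\<bar> \<le> (norm x)\<^sup>2 + (norm y)\<^sup>2" for x y :: 'b
    using zero_le_power2[of "norm x - norm y"] Cauchy_Schwarz_ineq2[of x y]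
      mult_nonneg_nonneg[OF norm_ge_zero[of x] norm_ge_zero[of y]]
    by (simp add: power2_eq_square algebra_simps)
  then show "AE \<omega> in M. norm (X \<omega> \<bullet> Y \<omega>) \<le> norm ((norm (X \<omega>))\<^sup>2 + (norm (Y \<omega>))\<^sup>2)"
    by simp
qed (use assms in \<open>auto simp: square_integrable_def\<close>)

lemma square_integrable_add:
  assumes "square_integrable X" "square_integrable Y"
  shows "square_integrable (\<lambda>\<omega>. X \<omega> + Y \<omega>)"
  using assms integrable_inner_square_integrable[OF assms]
  unfolding square_integrable_def
  by (intro conjI borel_measurable_add) (simp_all add: power2_norm_eq_inner inner_add_left inner_add_right inner_commute)

text \<open>Bias-variance decomposition: the cross term is linear in
  \<open>X - expectation X\<close> and has expectation zero. In particular the mean is the best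
  constant approximation.\<close>

lemma mean_square_decomposition:
  assumes X: "square_integrable X"
  shows "expectation (\<lambda>\<omega>. (norm (X \<omega> - c))\<^sup>2)
    = expectation (\<lambda>\<omega>. (norm (X \<omega> - expectation X))\<^sup>2) + (norm (expectation X - c))\<^sup>2"
proof -
  define m where "m = expectation X"
  have int: "integrable M X" "integrable M (\<lambda>\<omega>. (norm (X \<omega> - m))\<^sup>2)"
    using X square_integrable_imp_integrable square_integrable_diff_const
    by (auto simp: square_integrable_def)
  have "(norm (X \<omega> - c))\<^sup>2 = (norm (X \<omega> - m))\<^sup>2 + 2 * ((X \<omega> - m) \<bullet> (m - c)) + (norm (m - c))\<^sup>2" for \<omega>
    by (simp add: power2_norm_eq_inner inner_diff_left inner_diff_right inner_commute algebra_simps)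
  then have "expectation (\<lambda>\<omega>. (norm (X \<omega> - c))\<^sup>2)
    = expectation (\<lambda>\<omega>. (norm (X \<omega> - m))\<^sup>2) + 2 * expectation (\<lambda>\<omega>. (X \<omega> - m) \<bullet> (m - c)) + (norm (m - c))\<^sup>2"
    using int by (simp add: prob_space)
  also have "expectation (\<lambda>\<omega>. (X \<omega> - m) \<bullet> (m - c)) = 0"
    using int by (simp add: prob_space m_def[symmetric])
  finally show ?thesis
    by (simp add: m_def)
qed

text \<open>The linear Taylor term at the mean integrates to zero, so only the remainder
  \<open>r\<close> contributes; its quadratic bound yields integrability as well.\<close>

lemma expectation_minus_value_at_mean:
  assumes X: "square_integrable X" and C: "class_C 2 f" and "0 \<le> B"
    and B: "\<And>x k l. k \<noteq> 0 \<Longrightarrow> l \<noteq> 0 \<Longrightarrow> \<bar>deriv_along [k, l] f x\<bar> \<le> B * (norm k * norm l)"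
  shows "integrable M (\<lambda>\<omega>. f (X \<omega>))"
    and "\<bar>expectation (\<lambda>\<omega>. f (X \<omega>)) - f (expectation X)\<bar>
      \<le> B * expectation (\<lambda>\<omega>. (norm (X \<omega> - expectation X))\<^sup>2)"
proof -
  define m where "m = expectation X"
  define r where "r x = f x - f m - (x - m) \<bullet> gradient f m" for x
  have r: "\<bar>r x\<bar> \<le> B * (norm (x - m))\<^sup>2" for x
    using taylor_first_order[OF C \<open>0 \<le> B\<close> B] by (simp add: r_def)
  have int: "integrable M X" "integrable M (\<lambda>\<omega>. B * (norm (X \<omega> - m))\<^sup>2)"
    using X square_integrable_imp_integrable square_integrable_diff_const
    by (auto simp: square_integrable_def)
  have [measurable]: "f \<in> borel_measurable borel" "X \<in> borel_measurable M"
    using class_C_continuous[OF C] borel_measurable_continuous_onI X by (auto simp: square_integrable_def)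
  have int_r: "integrable M (\<lambda>\<omega>. r (X \<omega>))"
    using int(2) by (rule Bochner_Integration.integrable_bound)
      (use r \<open>0 \<le> B\<close> in \<open>auto simp: r_def abs_mult\<close>)
  have f: "f x = f m + (x - m) \<bullet> gradient f m + r x" for x
    by (simp add: r_def)
  show "integrable M (\<lambda>\<omega>. f (X \<omega>))"
    by (subst f) (use int int_r in auto)
  have "expectation (\<lambda>\<omega>. f (X \<omega>)) = f m + (m - m) \<bullet> gradient f m + expectation (\<lambda>\<omega>. r (X \<omega>))"
    by (subst f) (use int int_r in \<open>simp add: prob_space m_def[symmetric]\<close>)
  then have "\<bar>expectation (\<lambda>\<omega>. f (X \<omega>)) - f m\<bar> = \<bar>expectation (\<lambda>\<omega>. r (X \<omega>))\<bar>"
    by simp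
  also have "\<dots> \<le> expectation (\<lambda>\<omega>. B * (norm (X \<omega> - m))\<^sup>2)"
    using int int_r r by (intro order_trans[OF integral_abs_bound] integral_mono) auto
  finally show "\<bar>expectation (\<lambda>\<omega>. f (X \<omega>)) - f (expectation X)\<bar>
      \<le> B * expectation (\<lambda>\<omega>. (norm (X \<omega> - expectation X))\<^sup>2)"
    by (simp add: m_def)
qed

lemma indep_centered_product:
  fixes X Z :: "'a \<Rightarrow> real ^ 'd" and a :: "real ^ 'd \<Rightarrow> real"
  assumes ind: "indep_var borel X borel Z" and [measurable]: "a \<in> borel_measurable borel"
    and a: "integrable M (\<lambda>\<omega>. a (X \<omega>))"
    and Z: "integrable M Z" "expectation (\<lambda>\<omega>. Z \<omega> $ j) = 0"
  shows "integrable M (\<lambda>\<omega>. a (X \<omega>) * Z \<omega> $ j)" "expectation (\<lambda>\<omega>. a (X \<omega>) * Z \<omega> $ j) = 0"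
proof -
  have "indep_var borel (a \<circ> X) borel ((\<lambda>z. z $ j) \<circ> Z)"
    using ind by (rule indep_var_compose) auto
  then have "indep_var borel (\<lambda>\<omega>. a (X \<omega>)) borel (\<lambda>\<omega>. Z \<omega> $ j)"
    by (simp add: comp_def)
  moreover have "integrable M (\<lambda>\<omega>. Z \<omega> $ j)"
    using Z(1) by (rule integrable_bounded_linear[OF bounded_linear_vec_nth])
  ultimately show "integrable M (\<lambda>\<omega>. a (X \<omega>) * Z \<omega> $ j)" "expectation (\<lambda>\<omega>. a (X \<omega>) * Z \<omega> $ j) = 0"
    using a Z(2) indep_var_integrable indep_var_lebesgue_integral[of "\<lambda>\<omega>. a (X \<omega>)" "\<lambda>\<omega>. Z \<omega> $ j"] by auto
qed

text \<open>Independence factorizes everything: entry by entry, the mean and the cross term contain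
  a factor \<open>Z $ j\<close> of expectation zero, while \<open>norm_matrix_vector_mult_le\<close>
  bounds the mean square by a function of \<open>X\<close> times a function of
  \<open>Z\<close>.\<close>

lemma indep_centered_noise:
  fixes X Z :: "'a \<Rightarrow> real ^ 'd" and B :: "real ^ 'd \<Rightarrow> real ^ 'd ^ 'd"
  assumes ind: "indep_var borel X borel Z" and [measurable]: "B \<in> borel_measurable borel"
    and B: "square_integrable (\<lambda>\<omega>. B (X \<omega>))"
    and Z: "square_integrable Z" "\<And>j. expectation (\<lambda>\<omega>. Z \<omega> $ j) = 0"
  shows square_integrable_noise: "square_integrable (\<lambda>\<omega>. B (X \<omega>) *v Z \<omega>)"
    and noise_mean_square: "expectation (\<lambda>\<omega>. (norm (B (X \<omega>) *v Z \<omega>))\<^sup>2)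
      \<le> expectation (\<lambda>\<omega>. (norm (B (X \<omega>)))\<^sup>2) * expectation (\<lambda>\<omega>. (norm (Z \<omega>))\<^sup>2)"
    and expectation_noise: "expectation (\<lambda>\<omega>. B (X \<omega>) *v Z \<omega>) = 0"
    and expectation_inner_noise: "\<And>g. g \<in> borel_measurable borel \<Longrightarrow> square_integrable (\<lambda>\<omega>. g (X \<omega>)) \<Longrightarrow>
      expectation (\<lambda>\<omega>. g (X \<omega>) \<bullet> (B (X \<omega>) *v Z \<omega>)) = 0"
proof -
  have [measurable]: "X \<in> borel_measurable M" "Z \<in> borel_measurable M"
    using indep_var_rv1[OF ind] indep_var_rv2[OF ind] by auto
  have [measurable]: "(\<lambda>x. B x $ i $ j) \<in> borel_measurable borel" for i j
    by (rule measurable_compose[where N = borel and g = "\<lambda>A. A $ i $ j"])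
      (auto intro!: borel_measurable_continuous_onI continuous_intros)
  have BZ: "(B x *v z) $ i = (\<Sum>j\<in>UNIV. B x $ i $ j * z $ j)" for x i and z
    by (simp add: matrix_vector_mult_def)
  have "indep_var borel ((\<lambda>x. (norm (B x))\<^sup>2) \<circ> X) borel ((\<lambda>z. (norm z)\<^sup>2) \<circ> Z)"
    using ind by (rule indep_var_compose) auto
  then have "indep_var borel (\<lambda>\<omega>. (norm (B (X \<omega>)))\<^sup>2) borel (\<lambda>\<omega>. (norm (Z \<omega>))\<^sup>2)"
    by (simp add: comp_def)
  then have int: "integrable M (\<lambda>\<omega>. (norm (B (X \<omega>)))\<^sup>2 * (norm (Z \<omega>))\<^sup>2)"
    and eq: "expectation (\<lambda>\<omega>. (norm (B (X \<omega>)))\<^sup>2 * (norm (Z \<omega>))\<^sup>2)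
      = expectation (\<lambda>\<omega>. (norm (B (X \<omega>)))\<^sup>2) * expectation (\<lambda>\<omega>. (norm (Z \<omega>))\<^sup>2)"
    using B Z indep_var_integrable indep_var_lebesgue_integral by (auto simp: square_integrable_def)
  have le: "(norm (B x *v z))\<^sup>2 \<le> (norm (B x))\<^sup>2 * (norm z)\<^sup>2" for x z
    using power_mono[OF norm_matrix_vector_mult_le norm_ge_zero, of "B x" z 2]
    by (simp add: power_mult_distrib)
  have [measurable]: "(\<lambda>\<omega>. B (X \<omega>) *v Z \<omega>) \<in> borel_measurable M"
    unfolding matrix_vector_mult_def
    by (intro borel_measurable_continuous_Pair[where H = "\<lambda>A x. \<chi> i. \<Sum>j\<in>UNIV. A $ i $ j * x $ j"] continuous_intros)
      measurable
  have int_BZ: "integrable M (\<lambda>\<omega>. (norm (B (X \<omega>) *v Z \<omega>))\<^sup>2)"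
    using int by (rule Bochner_Integration.integrable_bound) (use le in auto)
  then show sq: "square_integrable (\<lambda>\<omega>. B (X \<omega>) *v Z \<omega>)"
    by (simp add: square_integrable_def)
  show "expectation (\<lambda>\<omega>. (norm (B (X \<omega>) *v Z \<omega>))\<^sup>2)
      \<le> expectation (\<lambda>\<omega>. (norm (B (X \<omega>)))\<^sup>2) * expectation (\<lambda>\<omega>. (norm (Z \<omega>))\<^sup>2)"
    unfolding eq[symmetric] using int_BZ int le by (rule integral_mono)
  have intZ: "integrable M Z"
    using Z(1) by (rule square_integrable_imp_integrable)
  have intB: "integrable M (\<lambda>\<omega>. B (X \<omega>) $ i $ j)" for i j
    using square_integrable_imp_integrable[OF B]
    by (intro integrable_bounded_linear[OF bounded_linear_vec_nth])
  have "expectation (\<lambda>\<omega>. B (X \<omega>) *v Z \<omega>) $ i = 0" for i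
  proof -
    have "expectation (\<lambda>\<omega>. B (X \<omega>) *v Z \<omega>) $ i = expectation (\<lambda>\<omega>. (B (X \<omega>) *v Z \<omega>) $ i)"
      using integral_bounded_linear[OF bounded_linear_vec_nth square_integrable_imp_integrable[OF sq]]
      by simp
    also have "\<dots> = 0"
      unfolding BZ using indep_centered_product[OF ind _ intB intZ Z(2)] by simp
    finally show ?thesis .
  qed
  then show "expectation (\<lambda>\<omega>. B (X \<omega>) *v Z \<omega>) = 0"
    by (simp add: vec_eq_iff)
  fix g :: "real ^ 'd \<Rightarrow> real ^ 'd"
  assume [measurable]: "g \<in> borel_measurable borel" and g: "square_integrable (\<lambda>\<omega>. g (X \<omega>))"
  have "\<bar>A $ i $ j\<bar> \<le> norm A" for A :: "real ^ 'd ^ 'd" and i j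
    using component_le_norm_cart[of "A $ i" j] Finite_Cartesian_Product.norm_nth_le[of A i] by linarith
  then have sq_component: "square_integrable (\<lambda>\<omega>. g (X \<omega>) $ i)"
    "square_integrable (\<lambda>\<omega>. B (X \<omega>) $ i $ j)" for i j
    using square_integrable_linear_growth[OF g, of "\<lambda>x. x $ i" 0 1]
      square_integrable_linear_growth[OF B, of "\<lambda>x. x $ i $ j" 0 1]
    by (simp_all add: component_le_norm_cart borel_measurable_continuous_onI continuous_intros)
  have "integrable M (\<lambda>\<omega>. g (X \<omega>) $ i * B (X \<omega>) $ i $ j)" for i j
    using integrable_inner_square_integrable[OF sq_component] by simp
  moreover have "(\<lambda>x. g x $ i * B x $ i $ j) \<in> borel_measurable borel" for i j
  proof (rule borel_measurable_times)
    show "(\<lambda>x. g x $ i) \<in> borel_measurable borel"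
      by (rule measurable_compose[where N = borel and g = "\<lambda>x. x $ i"])
        (auto intro!: borel_measurable_continuous_onI continuous_intros)
  qed simp
  \<comment> \<open>Here \<open>this\<close> is the measurability and \<open>calculation\<close> the
    integrability of \<open>g x $ i * B x $ i $ j\<close>, the coefficient of \<open>Z $ j\<close>
    in the cross term.\<close>
  note indep_centered_product[OF ind this calculation intZ Z(2)]
  then
  show "expectation (\<lambda>\<omega>. g (X \<omega>) \<bullet> (B (X \<omega>) *v Z \<omega>)) = 0"
    by (simp add: inner_vec_def BZ sum_distrib_left mult.assoc[symmetric])
qed

end

section \<open>The scheme with a fixed small step size\<close>

text \<open>The value \<open>b\<close> is the fixed point of the affine map
  \<open>u \<mapsto> (1 - a) * u + a * b\<close>, which is monotone for \<open>a \<le> 1\<close> and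
  so never carries a smaller value past \<open>b\<close>. Bounds obtained this way are uniform in
  \<open>n\<close>.\<close>

lemma recursion_bound:
  fixes u :: "nat \<Rightarrow> real"
  assumes u0: "u 0 \<le> b" and u: "\<And>n. u (Suc n) \<le> (1 - a) * u n + a * b" and a: "a \<le> 1"
  shows "u n \<le> b"
proof (induction n)
  case (Suc n)
  have "u (Suc n) \<le> (1 - a) * u n + a * b"
    by (rule u)
  also have "(1 - a) * u n \<le> (1 - a) * b"
    using Suc a by (intro mult_left_mono) auto
  finally show ?case
    by (simp add: algebra_simps)
qed (rule u0)

text \<open>\<open>S\<close> is the growth constant of the diffusion coefficient and
  \<open>D\<close> the second moment of a noise vector. Of the step-size conditions, the middle two
  make the gradient step a contraction, and the last one lets the noise consume at most half of the
  contraction gain.\<close>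

locale sg_fixed_step = prob_space M
  for M :: "'w measure" +
  fixes F :: "real ^ 'd \<Rightarrow> real"
    and \<sigma> :: "real \<Rightarrow> real ^ 'd \<Rightarrow> real ^ 'd ^ 'd"
    and \<gamma> :: "nat \<Rightarrow> 'w \<Rightarrow> real ^ 'd"
    and L \<mu> K S D h :: real
    and z x0 :: "real ^ 'd"
  assumes F: "class_C 3 F"
    and lipschitz: "\<And>x y. norm (gradient F y - gradient F x) \<le> L * norm (y - x)" and L: "0 < L"
    and monotone: "\<And>x y. \<mu> * (norm (y - x))\<^sup>2 \<le> (gradient F y - gradient F x) \<bullet> (y - x)" and \<mu>: "0 < \<mu>"
    and third: "\<And>u k l x. u \<noteq> 0 \<Longrightarrow> k \<noteq> 0 \<Longrightarrow> l \<noteq> 0 \<Longrightarrow>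
      \<bar>deriv_along [u, k, l] F x\<bar> \<le> K * norm u * (norm k * norm l)" and K: "0 \<le> K"
    and z: "gradient F z = 0"
    and \<sigma>_continuous: "\<And>t. 0 \<le> t \<Longrightarrow> continuous_on UNIV (\<sigma> t)"
    and \<sigma>_growth: "\<And>t x. 0 \<le> t \<Longrightarrow> norm (\<sigma> t x) \<le> S * (1 + norm (x - z))" and S: "0 \<le> S"
    and indep: "indep_vars (\<lambda>_. borel) \<gamma> {1..}"
    and \<gamma>_square: "\<And>n. 1 \<le> n \<Longrightarrow> square_integrable (\<gamma> n)"
    and \<gamma>_centered: "\<And>n j. 1 \<le> n \<Longrightarrow> expectation (\<lambda>\<omega>. \<gamma> n \<omega> $ j) = 0"
    and \<gamma>_moment: "\<And>n. 1 \<le> n \<Longrightarrow> expectation (\<lambda>\<omega>. (norm (\<gamma> n \<omega>))\<^sup>2) = D" and D: "0 \<le> D"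
    and h: "0 < h" "h * L\<^sup>2 \<le> \<mu>" "h * \<mu> \<le> 1" "h * (4 * D * S\<^sup>2) \<le> \<mu>"
begin

abbreviation X :: "nat \<Rightarrow> 'w \<Rightarrow> real ^ 'd" where
  "X \<equiv> sg_scheme F \<sigma> \<gamma> h x0"

abbreviation step :: "real ^ 'd \<Rightarrow> real ^ 'd" where
  "step x \<equiv> x - h *\<^sub>R gradient F x"

text \<open>The factor \<open>h\<close> sits inside the matrix, so that
  \<open>indep_centered_noise\<close> applies with the coefficient
  \<open>\<lambda>x. h *\<^sub>R \<sigma> (real n * h) x\<close>.\<close>

abbreviation noise :: "nat \<Rightarrow> 'w \<Rightarrow> real ^ 'd" where
  "noise n \<omega> \<equiv> (h *\<^sub>R \<sigma> (real n * h) (X n \<omega>)) *v \<gamma> (Suc n) \<omega>"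

text \<open>Chosen so that one noise term has mean square at most
  \<open>h\<^sup>2 * noise_const * (1 + moment n)\<close>; the factor 2 comes from
  \<open>(1 + r)\<^sup>2 \<le> 2 * (1 + r\<^sup>2)\<close>.\<close>

definition noise_const :: real where
  "noise_const = 2 * D * S\<^sup>2"

lemma noise_const_nonneg: "0 \<le> noise_const"
  using D by (simp add: noise_const_def)

lemma noise_const_h: "h * noise_const \<le> \<mu> / 2"
  using h by (simp add: noise_const_def)

lemma X_Suc: "X (Suc n) \<omega> = step (X n \<omega>) + noise n \<omega>"
  by (simp add: scaleR_matrix_vector_assoc)

lemma step_square: "(norm (step y - step x))\<^sup>2 \<le> (1 - h * \<mu>) * (norm (y - x))\<^sup>2"
  using gradient_step_contraction[OF lipschitz monotone L] h by simp

lemma step_norm: "norm (step y - step x) \<le> (1 - h * \<mu> / 2) * norm (y - x)"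
  using gradient_step_contraction_norm[OF lipschitz monotone L] h by simp

lemma step_z: "step z = z"
  by (simp add: z)

section \<open>Measurability, independence and square integrability of the iterates\<close>

lemma gradient_measurable [measurable]: "gradient F \<in> borel_measurable borel"
proof (intro borel_measurable_continuous_onI lipschitz_on_continuous_on)
  show "L-lipschitz_on UNIV (gradient F)"
    using lipschitz L by (auto simp: lipschitz_on_def dist_norm)
qed

lemma \<sigma>_measurable [measurable]: "\<sigma> (real n * h) \<in> borel_measurable borel"
  using h by (intro borel_measurable_continuous_onI \<sigma>_continuous) simp

text \<open>Feeding the coordinate maps as noise to the scheme exhibits \<open>X n\<close> as a function of
  \<open>\<gamma> 1, \<dots>, \<gamma> n\<close>.\<close>

lemma X_eq_coordinates:
  "n \<le> m \<Longrightarrow> X n \<omega> = sg_scheme F \<sigma> (\<lambda>k f. f k) h x0 n (restrict (\<lambda>i. \<gamma> i \<omega>) {1..m})"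
  by (induction n) auto

text \<open>The bound \<open>m\<close> is separate from \<open>n\<close> so that the product space
  stays the same along the induction.\<close>

lemma measurable_coordinates:
  "n \<le> m \<Longrightarrow> sg_scheme F \<sigma> (\<lambda>k f. f k) h x0 n \<in> borel_measurable (PiM {1..m} (\<lambda>_. borel))"
proof (induction n)
  case (Suc n)
  let ?\<Phi> = "sg_scheme F \<sigma> (\<lambda>k f. f k) h x0 n"
  have [measurable]: "?\<Phi> \<in> borel_measurable (PiM {1..m} (\<lambda>_. borel))"
    using Suc by simp
  have [measurable]: "(\<lambda>f. f (Suc n)) \<in> borel_measurable (PiM {1..m} (\<lambda>_. borel))"
    using Suc by (intro measurable_component_singleton) auto
  have [measurable]: "(\<lambda>f. \<sigma> (real n * h) (?\<Phi> f) *v f (Suc n)) \<in> borel_measurable (PiM {1..m} (\<lambda>_. borel))"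
    unfolding matrix_vector_mult_def
    by (intro borel_measurable_continuous_Pair[where H = "\<lambda>A x. \<chi> i. \<Sum>j\<in>UNIV. A $ i $ j * x $ j"] continuous_intros)
      measurable
  show ?case
    unfolding sg_scheme.simps by measurable
qed simp

text \<open>The iterate and the next noise vector are measurable functions of the disjoint blocks
  \<open>{1..n}\<close> and \<open>{Suc n}\<close> of an independent family.\<close>

lemma indep_X_\<gamma>: "indep_var borel (X n) borel (\<gamma> (Suc n))"
proof -
  have "indep_var (PiM {1..n} (\<lambda>_. borel)) (\<lambda>\<omega>. restrict (\<lambda>i. \<gamma> i \<omega>) {1..n})
      (PiM {Suc n} (\<lambda>_. borel)) (\<lambda>\<omega>. restrict (\<lambda>i. \<gamma> i \<omega>) {Suc n})"
    using indep by (rule indep_var_restrict) auto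
  then have "indep_var borel (sg_scheme F \<sigma> (\<lambda>k f. f k) h x0 n \<circ> (\<lambda>\<omega>. restrict (\<lambda>i. \<gamma> i \<omega>) {1..n}))
      borel ((\<lambda>f. f (Suc n)) \<circ> (\<lambda>\<omega>. restrict (\<lambda>i. \<gamma> i \<omega>) {Suc n}))"
    using measurable_coordinates[of n n] by (rule indep_var_compose) auto
  moreover have "sg_scheme F \<sigma> (\<lambda>k f. f k) h x0 n \<circ> (\<lambda>\<omega>. restrict (\<lambda>i. \<gamma> i \<omega>) {1..n}) = X n"
    unfolding comp_def by (rule ext) (rule X_eq_coordinates[symmetric], simp)
  moreover have "(\<lambda>f. f (Suc n)) \<circ> (\<lambda>\<omega>. restrict (\<lambda>i. \<gamma> i \<omega>) {Suc n}) = \<gamma> (Suc n)"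
    by (simp add: comp_def)
  ultimately show ?thesis
    by simp
qed

lemma square_integrable_step:
  assumes "square_integrable (X n)"
  shows "square_integrable (\<lambda>\<omega>. step (X n \<omega>))"
proof (rule square_integrable_linear_growth[OF assms, where a = "norm (step 0)" and b = 1])
  fix x
  have "norm (step x) \<le> norm (step 0) + norm (step x - step 0)"
    by (rule norm_triangle_sub)
  also have "norm (step x - step 0) \<le> 1 * norm (x - 0)"
    using h \<mu> by (intro order_trans[OF step_norm mult_right_mono]) auto
  finally show "norm (step x) \<le> norm (step 0) + 1 * norm x"
    by simp
qed simp

lemma square_integrable_\<sigma>:
  assumes "square_integrable (X n)"
  shows "square_integrable (\<lambda>\<omega>. \<sigma> (real n * h) (X n \<omega>))"
proof (rule square_integrable_linear_growth[OF assms, where a = "S * (1 + norm z)" and b = S])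
  fix x
  have "norm (\<sigma> (real n * h) x) \<le> S * (1 + norm (x - z))"
    using h by (intro \<sigma>_growth) simp
  also have "\<dots> \<le> S * (1 + (norm z + norm x))"
    using S norm_triangle_ineq4[of x z] by (intro mult_left_mono) auto
  finally show "norm (\<sigma> (real n * h) x) \<le> S * (1 + norm z) + S * norm x"
    by (simp add: algebra_simps)
qed simp

lemma square_integrable_scaled_\<sigma>:
  assumes "square_integrable (X n)"
  shows "square_integrable (\<lambda>\<omega>. h *\<^sub>R \<sigma> (real n * h) (X n \<omega>))"
  using square_integrable_\<sigma>[OF assms] by (auto simp: square_integrable_def power_mult_distrib)

lemma noise_facts:
  assumes "square_integrable (X n)"
  shows square_integrable_noise_step: "square_integrable (noise n)"
    and noise_step_mean_square: "expectation (\<lambda>\<omega>. (norm (noise n \<omega>))\<^sup>2)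
      \<le> h\<^sup>2 * D * expectation (\<lambda>\<omega>. (norm (\<sigma> (real n * h) (X n \<omega>)))\<^sup>2)"
    and expectation_noise_step: "expectation (noise n) = 0"
    and expectation_inner_noise_step: "\<And>g. g \<in> borel_measurable borel \<Longrightarrow> square_integrable (\<lambda>\<omega>. g (X n \<omega>)) \<Longrightarrow>
      expectation (\<lambda>\<omega>. g (X n \<omega>) \<bullet> noise n \<omega>) = 0"
proof -
  have "1 \<le> Suc n"
    by simp
  have [measurable]: "(\<lambda>x. h *\<^sub>R \<sigma> (real n * h) x) \<in> borel_measurable borel"
    by measurable
  note facts = indep_centered_noise[where B = "\<lambda>x. h *\<^sub>R \<sigma> (real n * h) x",
    OF indep_X_\<gamma> this square_integrable_scaled_\<sigma>[OF assms] \<gamma>_square \<gamma>_centered,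
    OF \<open>1 \<le> Suc n\<close> \<open>1 \<le> Suc n\<close>]
  show "square_integrable (noise n)" "expectation (noise n) = 0"
    using facts(1,3) by simp_all
  show "expectation (\<lambda>\<omega>. g (X n \<omega>) \<bullet> noise n \<omega>) = 0"
    if "g \<in> borel_measurable borel" "square_integrable (\<lambda>\<omega>. g (X n \<omega>))" for g
    using facts(4)[OF that] by simp
  show "expectation (\<lambda>\<omega>. (norm (noise n \<omega>))\<^sup>2)
      \<le> h\<^sup>2 * D * expectation (\<lambda>\<omega>. (norm (\<sigma> (real n * h) (X n \<omega>)))\<^sup>2)"
    using facts(2) \<gamma>_moment[OF \<open>1 \<le> Suc n\<close>] by (simp add: power_mult_distrib mult_ac)
qed

lemma square_integrable_X: "square_integrable (X n)"
proof (induction n)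
  case 0
  show ?case
    by (simp add: square_integrable_def)
next
  case (Suc n)
  then have "square_integrable (\<lambda>\<omega>. step (X n \<omega>) + noise n \<omega>)"
    by (intro square_integrable_add square_integrable_step square_integrable_noise_step)
  then show ?case
    unfolding X_Suc[symmetric] .
qed

lemma integrable_norm_square_diff: "integrable M (\<lambda>\<omega>. (norm (X n \<omega> - c))\<^sup>2)"
  using square_integrable_diff_const[OF square_integrable_X] by (simp add: square_integrable_def)

lemma expectation_X_Suc: "expectation (X (Suc n)) = expectation (\<lambda>\<omega>. step (X n \<omega>))"
proof -
  have "expectation (\<lambda>\<omega>. step (X n \<omega>) + noise n \<omega>) = expectation (\<lambda>\<omega>. step (X n \<omega>)) + expectation (noise n)"
    using square_integrable_X
    by (intro Bochner_Integration.integral_add square_integrable_imp_integrable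
        square_integrable_step square_integrable_noise_step)
  then show ?thesis
    unfolding X_Suc[symmetric] expectation_noise_step[OF square_integrable_X] by simp
qed

section \<open>Second moments and variance, uniformly in the number of steps\<close>

abbreviation moment :: "nat \<Rightarrow> real" where
  "moment n \<equiv> expectation (\<lambda>\<omega>. (norm (X n \<omega> - z))\<^sup>2)"

abbreviation mean :: "nat \<Rightarrow> real ^ 'd" where
  "mean n \<equiv> expectation (X n)"

abbreviation var :: "nat \<Rightarrow> real" where
  "var n \<equiv> expectation (\<lambda>\<omega>. (norm (X n \<omega> - mean n))\<^sup>2)"

lemma \<sigma>_mean_square:
  "expectation (\<lambda>\<omega>. (norm (\<sigma> (real n * h) (X n \<omega>)))\<^sup>2) \<le> 2 * S\<^sup>2 * (1 + moment n)"
proof -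
  have "(norm (\<sigma> (real n * h) x))\<^sup>2 \<le> 2 * S\<^sup>2 * (1 + (norm (x - z))\<^sup>2)" for x
  proof -
    have "(norm (\<sigma> (real n * h) x))\<^sup>2 \<le> (S * (1 + norm (x - z)))\<^sup>2"
      using h by (intro power_mono \<sigma>_growth) auto
    also have "\<dots> = S\<^sup>2 * (1 + norm (x - z))\<^sup>2"
      by (simp add: power_mult_distrib)
    also have "\<dots> \<le> S\<^sup>2 * (2 * (1 + (norm (x - z))\<^sup>2))"
      using zero_le_power2[of "1 - norm (x - z)"]
      by (intro mult_left_mono) (simp_all add: power2_eq_square algebra_simps)
    finally show ?thesis
      by (simp add: algebra_simps)
  qed
  then have "expectation (\<lambda>\<omega>. (norm (\<sigma> (real n * h) (X n \<omega>)))\<^sup>2)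
      \<le> expectation (\<lambda>\<omega>. 2 * S\<^sup>2 * (1 + (norm (X n \<omega> - z))\<^sup>2))"
    using square_integrable_\<sigma>[OF square_integrable_X[of n]] integrable_norm_square_diff
    by (intro integral_mono) (auto simp: square_integrable_def)
  also have "\<dots> = 2 * S\<^sup>2 * (1 + moment n)"
    using integrable_norm_square_diff by (simp add: prob_space)
  finally show ?thesis .
qed

text \<open>The noise is centered and independent of the current state, so there is no cross term.\<close>

lemma mean_square_step:
  "expectation (\<lambda>\<omega>. (norm (X (Suc n) \<omega> - step c))\<^sup>2)
    \<le> (1 - h * \<mu>) * expectation (\<lambda>\<omega>. (norm (X n \<omega> - c))\<^sup>2) + h\<^sup>2 * noise_const * (1 + moment n)"
proof -
  let ?d = "\<lambda>\<omega>. step (X n \<omega>) - step c"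
  note sq = square_integrable_X[of n]
  have d: "square_integrable ?d"
    using square_integrable_diff_const[OF square_integrable_step[OF sq]] .
  have int: "integrable M (\<lambda>\<omega>. (norm (?d \<omega>))\<^sup>2)" "integrable M (\<lambda>\<omega>. (norm (noise n \<omega>))\<^sup>2)"
    using d square_integrable_noise_step[OF sq] by (auto simp: square_integrable_def)
  have int_cross: "integrable M (\<lambda>\<omega>. ?d \<omega> \<bullet> noise n \<omega>)"
    using d square_integrable_noise_step[OF sq] by (rule integrable_inner_square_integrable)
  have norm_add: "(norm (u + v))\<^sup>2 = (norm u)\<^sup>2 + 2 * (u \<bullet> v) + (norm v)\<^sup>2" for u v :: "real ^ 'd"
    by (simp add: power2_norm_eq_inner inner_add_left inner_add_right inner_commute)
  have "X (Suc n) \<omega> - step c = ?d \<omega> + noise n \<omega>" for \<omega>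
    unfolding X_Suc by (rule diff_add_eq[symmetric])
  then have "(norm (X (Suc n) \<omega> - step c))\<^sup>2
      = (norm (?d \<omega>))\<^sup>2 + 2 * (?d \<omega> \<bullet> noise n \<omega>) + (norm (noise n \<omega>))\<^sup>2" for \<omega>
    by (simp only: norm_add)
  then have "expectation (\<lambda>\<omega>. (norm (X (Suc n) \<omega> - step c))\<^sup>2)
      = expectation (\<lambda>\<omega>. (norm (?d \<omega>))\<^sup>2) + 2 * expectation (\<lambda>\<omega>. ?d \<omega> \<bullet> noise n \<omega>)
        + expectation (\<lambda>\<omega>. (norm (noise n \<omega>))\<^sup>2)"
    using int int_cross by (simp only: Bochner_Integration.integral_add Bochner_Integration.integrable_add
      integral_mult_right_zero integrable_mult_right)
  also have "expectation (\<lambda>\<omega>. ?d \<omega> \<bullet> noise n \<omega>) = 0"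
    using d by (intro expectation_inner_noise_step[OF sq, of "\<lambda>x. step x - step c"]) simp_all
  also have "expectation (\<lambda>\<omega>. (norm (?d \<omega>))\<^sup>2) \<le> expectation (\<lambda>\<omega>. (1 - h * \<mu>) * (norm (X n \<omega> - c))\<^sup>2)"
    using int(1) integrable_norm_square_diff step_square by (intro integral_mono) auto
  also have "expectation (\<lambda>\<omega>. (norm (noise n \<omega>))\<^sup>2) \<le> h\<^sup>2 * D * (2 * S\<^sup>2 * (1 + moment n))"
    using noise_step_mean_square[OF sq] mult_left_mono[OF \<sigma>_mean_square, of "h\<^sup>2 * D" n] D
    by simp
  finally show ?thesis
    by (simp add: noise_const_def mult_ac)
qed

text \<open>With \<open>a = h * \<mu> / 2\<close>, the contraction gains \<open>2 * a\<close> and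
  the noise gives back at most \<open>a * (1 + moment n)\<close> by \<open>noise_const_h\<close>.
  The resulting recursion with factor \<open>1 - a\<close> and source \<open>a\<close> preserves the
  bound.\<close>

lemma moment_bound: "moment n \<le> (norm (x0 - z))\<^sup>2 + 1"
proof (induction n)
  case 0
  show ?case
    by (simp add: prob_space)
next
  case (Suc n)
  define a where "a = h * \<mu> / 2"
  have "0 \<le> moment n"
    by simp
  have "moment (Suc n) \<le> (1 - 2 * a) * moment n + h\<^sup>2 * noise_const * (1 + moment n)"
    using mean_square_step[of n z] by (simp add: step_z a_def)
  also have "h\<^sup>2 * noise_const * (1 + moment n) \<le> a * (1 + moment n)"
    using mult_left_mono[OF noise_const_h, of h] h \<open>0 \<le> moment n\<close>
    by (intro mult_right_mono) (auto simp: a_def power2_eq_square)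
  also have "(1 - 2 * a) * moment n + a * (1 + moment n) = (1 - a) * moment n + a"
    by (simp add: algebra_simps)
  also have "(1 - a) * moment n \<le> (1 - a) * ((norm (x0 - z))\<^sup>2 + 1)"
    using Suc h by (intro mult_left_mono) (auto simp: a_def)
  also have "\<dots> + a \<le> (norm (x0 - z))\<^sup>2 + 1"
    using h \<mu> by (simp add: a_def algebra_simps)
  finally show ?case
    by simp
qed

text \<open>The initial value is deterministic, so \<open>var 0 = 0\<close>. Each step contracts by
  \<open>1 - h * \<mu>\<close> and adds a term of order \<open>h\<^sup>2\<close>, so the fixed point
  of the recursion is of order \<open>h\<close>.\<close>

lemma var_bound: "var n \<le> h * (noise_const / \<mu> * (2 + (norm (x0 - z))\<^sup>2))"
proof (rule recursion_bound[where u = var and a = "h * \<mu>"])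
  show "var 0 \<le> h * (noise_const / \<mu> * (2 + (norm (x0 - z))\<^sup>2))"
    using h \<mu> noise_const_nonneg by (simp add: prob_space)
  show "h * \<mu> \<le> 1"
    by (rule h)
  show "var (Suc n) \<le> (1 - h * \<mu>) * var n + h * \<mu> * (h * (noise_const / \<mu> * (2 + (norm (x0 - z))\<^sup>2)))" for n
  proof -
    \<comment> \<open>The variance is the smallest mean-square distance to a constant; the constant
      \<open>step (mean n)\<close> lets the contraction act around \<open>mean n\<close>.\<close>
    have "var (Suc n) \<le> expectation (\<lambda>\<omega>. (norm (X (Suc n) \<omega> - step (mean n)))\<^sup>2)"
      using mean_square_decomposition[OF square_integrable_X[of "Suc n"], of "step (mean n)"] by simp
    also have "\<dots> \<le> (1 - h * \<mu>) * var n + h\<^sup>2 * noise_const * (1 + moment n)"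
      by (rule mean_square_step)
    also have "h\<^sup>2 * noise_const * (1 + moment n) \<le> h\<^sup>2 * noise_const * (2 + (norm (x0 - z))\<^sup>2)"
      using moment_bound[of n] noise_const_nonneg by (intro mult_left_mono) auto
    also have "\<dots> = h * \<mu> * (h * (noise_const / \<mu> * (2 + (norm (x0 - z))\<^sup>2)))"
      using \<mu> by (simp add: power2_eq_square)
    finally show ?thesis
      by simp
  qed
qed

text \<open>Jensen's inequality, by dropping the variance in the bias-variance
  decomposition.\<close>

lemma mean_bound: "norm (mean n - z) \<le> norm (x0 - z) + 1"
proof (rule power2_le_imp_le)
  have "(norm (mean n - z))\<^sup>2 \<le> moment n"
    using mean_square_decomposition[OF square_integrable_X[of n], of z] by simp
  also have "\<dots> \<le> (norm (x0 - z))\<^sup>2 + 1"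
    by (rule moment_bound)
  also have "\<dots> \<le> (norm (x0 - z) + 1)\<^sup>2"
    by (simp add: power2_eq_square algebra_simps)
  finally show "(norm (mean n - z))\<^sup>2 \<le> (norm (x0 - z) + 1)\<^sup>2" .
qed simp

section \<open>Bias of the mean and the weak error\<close>

lemma gradient_differentiable: "F differentiable (at x)"
  using F by (simp add: numeral_3_eq_3)

lemma integrable_gradient_X: "integrable M (\<lambda>\<omega>. gradient F (X n \<omega>))"
proof -
  \<comment> \<open>The gradient is recovered from the gradient step, already known to be square
    integrable.\<close>
  have "integrable M (\<lambda>\<omega>. (1 / h) *\<^sub>R (X n \<omega> - step (X n \<omega>)))"
    using square_integrable_X
    by (intro integrable_scaleR_right Bochner_Integration.integrable_diff
        square_integrable_imp_integrable square_integrable_step)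
  then show ?thesis
    using h by simp
qed

text \<open>Testing against the error vector \<open>u\<close> itself reduces the claim to the scalar function
  \<open>x \<mapsto> u \<bullet> \<nabla>F(x)\<close>, whose second derivative is controlled by the third derivative of \<open>F\<close>.\<close>

lemma expectation_gradient:
  "norm (expectation (\<lambda>\<omega>. gradient F (X n \<omega>)) - gradient F (mean n)) \<le> K * var n"
proof -
  define u where "u = expectation (\<lambda>\<omega>. gradient F (X n \<omega>)) - gradient F (mean n)"
  let ?f = "\<lambda>x. frechet_derivative F (at x) u"
  show ?thesis
  proof (cases "u = 0")
    case True
    then show ?thesis
      using K by (simp add: u_def)
  next
    case False
    have f: "?f x = u \<bullet> gradient F x" for x
      by (rule frechet_derivative_gradient[OF gradient_differentiable])
    have "class_C 2 ?f"
      using F by (simp add: numeral_3_eq_3 numeral_2_eq_2)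
    then have "\<bar>expectation (\<lambda>\<omega>. ?f (X n \<omega>)) - ?f (mean n)\<bar> \<le> K * norm u * var n"
      using third[OF False] K
      by (intro expectation_minus_value_at_mean[OF square_integrable_X]) auto
    also have "expectation (\<lambda>\<omega>. ?f (X n \<omega>)) - ?f (mean n) = u \<bullet> u"
      unfolding f using integrable_gradient_X by (simp add: u_def inner_diff_right)
    finally have "norm u * norm u \<le> norm u * (K * var n)"
      by (simp add: dot_square_norm power2_eq_square mult_ac)
    then show ?thesis
      using False unfolding u_def[symmetric] by simp
  qed
qed

text \<open>One step transports the old error with factor \<open>1 - h * \<mu> / 2\<close> and adds
  two terms of order \<open>h\<^sup>2\<close>: \<open>h\<close> times the gap between the mean
  gradient and the gradient at the mean, and the Euler error of the flow. Dividing by the loss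
  \<open>h * \<mu> / 2\<close> gives order \<open>h\<close> and the factor
  \<open>2 / \<mu>\<close>.\<close>

lemma mean_error:
  assumes sol: "gradient_system_solution F x0 \<X>"
  defines "R \<equiv> norm (x0 - z)"
  shows "norm (mean n - \<X> (real n * h)) \<le> h * (2 / \<mu> * (K * noise_const / \<mu> * (2 + R\<^sup>2) + L\<^sup>2 * R))"
proof (rule recursion_bound[where u = "\<lambda>n. norm (mean n - \<X> (real n * h))" and a = "h * \<mu> / 2"])
  let ?x = "\<lambda>n. \<X> (real n * h)"
  let ?b = "h * (2 / \<mu> * (K * noise_const / \<mu> * (2 + R\<^sup>2) + L\<^sup>2 * R))"
  have "\<X> 0 = x0"
    using sol by (simp add: gradient_system_solution_def)
  then show "norm (mean 0 - ?x 0) \<le> ?b"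
    using h \<mu> K L noise_const_nonneg by (simp add: prob_space R_def)
  show "h * \<mu> / 2 \<le> 1"
    using h by simp
  show "norm (mean (Suc n) - ?x (Suc n)) \<le> (1 - h * \<mu> / 2) * norm (mean n - ?x n) + h * \<mu> / 2 * ?b" for n
  proof -
    let ?e = "expectation (\<lambda>\<omega>. gradient F (X n \<omega>)) - gradient F (mean n)"
    let ?l = "?x (Suc n) - step (?x n)"
    have "mean (Suc n) = mean n - h *\<^sub>R expectation (\<lambda>\<omega>. gradient F (X n \<omega>))"
      unfolding expectation_X_Suc
      using square_integrable_imp_integrable[OF square_integrable_X[of n]] integrable_gradient_X[of n] by simp
    then have "mean (Suc n) - ?x (Suc n) = (step (mean n) - step (?x n)) - h *\<^sub>R ?e - ?l"
      by (simp add: algebra_simps)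
    then have "norm (mean (Suc n) - ?x (Suc n)) \<le> norm (step (mean n) - step (?x n)) + norm (h *\<^sub>R ?e) + norm ?l"
      by (simp only:) (rule order_trans[OF norm_triangle_ineq4 add_right_mono[OF norm_triangle_ineq4]])
    also have "norm (step (mean n) - step (?x n)) \<le> (1 - h * \<mu> / 2) * norm (mean n - ?x n)"
      by (rule step_norm)
    also have "norm (h *\<^sub>R ?e) \<le> h * (K * (h * (noise_const / \<mu> * (2 + R\<^sup>2))))"
      using mult_left_mono[OF order_trans[OF expectation_gradient mult_left_mono[OF var_bound K]], of h n] h
      by (simp add: R_def)
    also have "norm ?l \<le> h\<^sup>2 * L\<^sup>2 * R"
    proof -
      have "0 \<le> (gradient F y - gradient F x) \<bullet> (y - x)" for x y
        using \<mu> by (intro order_trans[OF _ monotone]) simp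
      then have "norm (\<X> (real n * h + h) - step (?x n)) \<le> h\<^sup>2 * L\<^sup>2 * R"
        unfolding R_def using h L
        by (intro gradient_system_local_error[OF sol lipschitz _ _ z]) auto
      then show ?thesis
        by (simp add: algebra_simps)
    qed
    also have "(1 - h * \<mu> / 2) * norm (mean n - ?x n) + h * (K * (h * (noise_const / \<mu> * (2 + R\<^sup>2)))) + h\<^sup>2 * L\<^sup>2 * R
        = (1 - h * \<mu> / 2) * norm (mean n - ?x n) + h * \<mu> / 2 * ?b"
      using \<mu> by (simp add: field_simps power2_eq_square)
    finally show ?thesis
      by simp
  qed
qed

text \<open>The error splits at \<open>\<phi> (mean n)\<close> into a fluctuation part, bounded by
  \<open>B * var n\<close>, and a bias part, bounded through \<open>mean_error\<close>. In the
  latter the local Lipschitz constant, linear in \<open>R\<close>, multiplies an error quadratic in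
  \<open>R\<close>, whence the cubic growth.\<close>

lemma weak_error:
  assumes sol: "gradient_system_solution F x0 \<X>"
    and \<phi>: "class_C 2 \<phi>" and "0 \<le> B"
    and B: "\<And>x k l. k \<noteq> 0 \<Longrightarrow> l \<noteq> 0 \<Longrightarrow> \<bar>deriv_along [k, l] \<phi> x\<bar> \<le> B * (norm k * norm l)"
  shows "integrable M (\<lambda>\<omega>. \<phi> (X n \<omega>))"
    and "\<bar>expectation (\<lambda>\<omega>. \<phi> (X n \<omega>)) - \<phi> (\<X> (real n * h))\<bar>
      \<le> (3 * (noise_const / \<mu>) + 2 / \<mu> * (6 * (K * noise_const / \<mu>) + 2 * L\<^sup>2))
        * (norm (gradient \<phi> z) + B) * (1 + norm (x0 - z) ^ 3) * h"
proof -
  define R where "R = norm (x0 - z)"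
  define g where "g = norm (gradient \<phi> z)"
  define c where "c = noise_const / \<mu>"
  have nonneg: "0 \<le> R" "0 \<le> g" "0 \<le> c"
    using noise_const_nonneg \<mu> by (auto simp: R_def g_def c_def)
  let ?x = "\<X> (real n * h)"
  let ?p = "2 / \<mu> * (K * c * (2 + R\<^sup>2) + L\<^sup>2 * R)"
  note mean_approx = expectation_minus_value_at_mean[OF square_integrable_X[of n] \<phi> \<open>0 \<le> B\<close> B]
  show "integrable M (\<lambda>\<omega>. \<phi> (X n \<omega>))"
    by (rule mean_approx)
  have "0 \<le> (gradient F y - gradient F x) \<bullet> (y - x)" for x y
    using \<mu> by (intro order_trans[OF _ monotone]) simp
  then have "norm (?x - z) \<le> R"
    unfolding R_def using h by (intro gradient_system_norm_le[OF sol _ z]) auto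
  \<comment> \<open>Both the mean and the solution lie within \<open>R + 1\<close> of
    \<open>z\<close>.\<close>
  then have "\<bar>\<phi> (mean n) - \<phi> ?x\<bar> \<le> (g + B * (R + 1)) * norm (mean n - ?x)"
    unfolding g_def using mean_bound[of n] \<open>0 \<le> B\<close>
    by (intro increment_bound[OF \<phi> B]) (auto simp: R_def)
  also have "\<dots> \<le> ((g + B) * (R + 1)) * (h * ?p)"
  proof (rule mult_mono)
    show "norm (mean n - ?x) \<le> h * ?p"
      using mean_error[OF sol, of n] by (simp add: R_def c_def)
    show "g + B * (R + 1) \<le> (g + B) * (R + 1)"
      using nonneg by (simp add: algebra_simps)
  qed (use nonneg \<open>0 \<le> B\<close> in auto)
  finally have bias: "\<bar>\<phi> (mean n) - \<phi> ?x\<bar> \<le> (g + B) * h * ((R + 1) * ?p)"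
    by (simp add: mult_ac)
  have "B * var n \<le> (g + B) * (h * (c * (2 + R\<^sup>2)))"
    using nonneg \<open>0 \<le> B\<close> var_bound[of n] by (intro mult_mono) (auto simp: R_def c_def)
  then have fluctuation: "B * var n \<le> (g + B) * h * (c * (2 + R\<^sup>2))"
    by (simp add: mult_ac)
  \<comment> \<open>Lower powers of \<open>R\<close> are at most 1 if \<open>R \<le> 1\<close> and
    at most \<open>R ^ 3\<close> otherwise.\<close>
  have cube: "R \<le> 1 + R ^ 3" "R\<^sup>2 \<le> 1 + R ^ 3"
  proof -
    have "R \<le> 1 \<or> R \<le> R ^ 3" "R\<^sup>2 \<le> 1 \<or> R\<^sup>2 \<le> R ^ 3"
      using nonneg(1) power_increasing[of 1 3 R] power_increasing[of 2 3 R] power_le_one[of R 2] by fastforce+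
    moreover have "0 \<le> R ^ 3"
      using nonneg(1) by simp
    ultimately show "R \<le> 1 + R ^ 3" "R\<^sup>2 \<le> 1 + R ^ 3"
      by linarith+
  qed
  have "2 + R\<^sup>2 \<le> 3 * (1 + R ^ 3)"
    using cube zero_le_power[OF nonneg(1), of 3] unfolding distrib_left by linarith
  then have "c * (2 + R\<^sup>2) \<le> c * (3 * (1 + R ^ 3))"
    using nonneg by (intro mult_left_mono)
  moreover have "(R + 1) * ?p \<le> 2 / \<mu> * (6 * (K * c) + 2 * L\<^sup>2) * (1 + R ^ 3)"
  proof -
    have "(R + 1) * (2 + R\<^sup>2) = 2 + 2 * R + R\<^sup>2 + R ^ 3"
      by (simp add: power2_eq_square power3_eq_cube algebra_simps)
    also have "\<dots> \<le> 6 * (1 + R ^ 3)"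
      using cube zero_le_power[OF nonneg(1), of 3] unfolding distrib_left by linarith
    finally have "K * c * ((R + 1) * (2 + R\<^sup>2)) \<le> K * c * (6 * (1 + R ^ 3))"
      using K nonneg by (intro mult_left_mono) auto
    moreover have "L\<^sup>2 * ((R + 1) * R) \<le> L\<^sup>2 * (2 * (1 + R ^ 3))"
      using cube by (intro mult_left_mono) (auto simp: power2_eq_square algebra_simps)
    ultimately have "2 / \<mu> * (K * c * ((R + 1) * (2 + R\<^sup>2)) + L\<^sup>2 * ((R + 1) * R))
        \<le> 2 / \<mu> * (K * c * (6 * (1 + R ^ 3)) + L\<^sup>2 * (2 * (1 + R ^ 3)))"
      using \<mu> by (intro mult_left_mono[of _ _ "2 / \<mu>"] add_mono) auto
    then show ?thesis
      by (simp add: algebra_simps add_divide_distrib)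
  qed
  ultimately have "c * (2 + R\<^sup>2) + (R + 1) * ?p
      \<le> (3 * c + 2 / \<mu> * (6 * (K * c) + 2 * L\<^sup>2)) * (1 + R ^ 3)"
    by (simp add: algebra_simps)
  then have "(g + B) * h * (c * (2 + R\<^sup>2) + (R + 1) * ?p)
      \<le> (g + B) * h * ((3 * c + 2 / \<mu> * (6 * (K * c) + 2 * L\<^sup>2)) * (1 + R ^ 3))"
    using nonneg \<open>0 \<le> B\<close> h by (intro mult_left_mono) auto
  moreover have "\<bar>expectation (\<lambda>\<omega>. \<phi> (X n \<omega>)) - \<phi> ?x\<bar> \<le> (g + B) * h * (c * (2 + R\<^sup>2) + (R + 1) * ?p)"
    using mean_approx(2) bias fluctuation unfolding distrib_left[of "(g + B) * h"] by linarith
  ultimately have "\<bar>expectation (\<lambda>\<omega>. \<phi> (X n \<omega>)) - \<phi> ?x\<bar>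
      \<le> (g + B) * h * ((3 * c + 2 / \<mu> * (6 * (K * c) + 2 * L\<^sup>2)) * (1 + R ^ 3))"
    by linarith
  then show "\<bar>expectation (\<lambda>\<omega>. \<phi> (X n \<omega>)) - \<phi> ?x\<bar>
      \<le> (3 * (noise_const / \<mu>) + 2 / \<mu> * (6 * (K * noise_const / \<mu>) + 2 * L\<^sup>2))
        * (norm (gradient \<phi> z) + B) * (1 + norm (x0 - z) ^ 3) * h"
    by (simp add: R_def g_def c_def mult_ac)
qed

end

section \<open>Choice of the step-size threshold and of the constant\<close>

theorem proposition5p1:
  fixes F :: "real ^ 'd \<Rightarrow> real"
    and \<sigma> :: "real \<Rightarrow> real ^ 'd \<Rightarrow> real ^ 'd ^ 'd"
    and h_max :: real
    and M :: "'w measure"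
    and \<gamma> :: "nat \<Rightarrow> 'w \<Rightarrow> real ^ 'd"
  assumes "h_max > 0"
    and "prob_space M"
    and "iid_std_gaussian M \<gamma>"
    and "F_basic F"
    and "sigma_basic F \<sigma>"
  shows "\<exists>H\<in>{0<..<h_max}. \<exists>C>0.
    \<forall>\<phi> :: real ^ 'd \<Rightarrow> real. class_C 2 \<phi> \<and> bounded_deriv 2 \<phi> \<longrightarrow>
      (\<forall>x0. \<forall>h\<in>{0<..<H}. \<forall>\<X>. gradient_system_solution F x0 \<X> \<longrightarrow>
        (\<forall>N\<ge>1. integrable M (\<lambda>\<omega>. \<phi> (sg_scheme F \<sigma> \<gamma> h x0 N \<omega>))) \<and>
        (SUP N\<in>{1..}. ereal \<bar>(\<integral>\<omega>. \<phi> (sg_scheme F \<sigma> \<gamma> h x0 N \<omega>) \<partial>M) - \<phi> (\<X> (real N * h))\<bar>)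
          \<le> ereal (C * (norm (gradient \<phi> (minimizer F)) + deriv_norm 2 \<phi>)
                     * (1 + norm (x0 - minimizer F) ^ 3) * h))"
proof -
  interpret prob_space M
    by (rule assms(2))
  define z where "z = minimizer F"
  obtain L \<mu> where F: "class_C 3 F" "bounded_deriv 3 F"
    and L: "0 < L" "\<And>x y. norm (gradient F y - gradient F x) \<le> L * norm (y - x)"
    and \<mu>: "0 < \<mu>" "\<And>x y. \<mu> * (norm (y - x))\<^sup>2 \<le> (gradient F y - gradient F x) \<bullet> (y - x)"
    using assms(4) unfolding F_basic_def by blast
  have "F differentiable (at x)" for x
    using F by (simp add: numeral_3_eq_3)
  then have z: "gradient F z = 0"
    unfolding z_def by (rule gradient_minimizer[OF _ L(2) \<mu>(2) L(1) \<mu>(1)])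
  define K where "K = deriv_norm 3 F"
  have K: "0 \<le> K"
    unfolding K_def by (rule deriv_norm_nonneg[OF F(2)])
  have third: "\<bar>deriv_along [u, k, l] F x\<bar> \<le> K * norm u * (norm k * norm l)"
    if "u \<noteq> 0" "k \<noteq> 0" "l \<noteq> 0" for u k l x
    using bounded_derivD[OF F(2), of "[u, k, l]" x] that by (simp add: K_def mult_ac)
  obtain s where \<sigma>_cont: "continuous_on ({0..} \<times> UNIV) (\<lambda>(t, x). \<sigma> t x)" and s: "bounded (s ` {0..})"
    and \<sigma>_le: "\<And>t x. 0 \<le> t \<Longrightarrow> norm (\<sigma> t x) / (1 + norm (x - z)) \<le> s t"
    using assms(5) unfolding sigma_basic_def z_def by blast
  obtain S where S: "0 < S" "\<And>t. 0 \<le> t \<Longrightarrow> \<bar>s t\<bar> \<le> S"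
    using s unfolding bounded_pos by auto
  have \<sigma>_growth: "norm (\<sigma> t x) \<le> S * (1 + norm (x - z))" if "0 \<le> t" for t x
  proof -
    have "0 < 1 + norm (x - z)"
      using norm_ge_zero[of "x - z"] by linarith
    moreover have "norm (\<sigma> t x) / (1 + norm (x - z)) \<le> S"
      using \<sigma>_le[OF that, of x] S(2)[OF that] by linarith
    ultimately show ?thesis
      by (simp add: pos_divide_le_eq)
  qed
  have \<sigma>_continuous: "continuous_on UNIV (\<sigma> t)" if "0 \<le> t" for t
  proof -
    have "continuous_on UNIV ((\<lambda>(t, x). \<sigma> t x) \<circ> Pair t)"
      using that by (intro continuous_on_compose continuous_on_subset[OF \<sigma>_cont] continuous_intros) auto
    then show ?thesis
      by (simp add: comp_def)
  qed
  define D where "D = (\<integral>x. std_gaussian_density x * (norm x)\<^sup>2 \<partial>(lborel :: (real ^ 'd) measure))"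
  have D: "0 \<le> D"
    by (simp add: D_def std_gaussian_density_nonneg)
  have indep: "indep_vars (\<lambda>_. borel) \<gamma> {1..}"
    and gauss: "\<And>n. 1 \<le> n \<Longrightarrow> distributed M lborel (\<gamma> n) (\<lambda>x. ennreal (std_gaussian_density x))"
    using assms(3) by (auto simp: iid_std_gaussian_def)
  have \<gamma>_square: "square_integrable (\<gamma> n)" if "1 \<le> n" for n
    using distributed_std_gaussian_moments(1)[OF gauss[OF that]] indep that
    by (auto simp: square_integrable_def indep_vars_def)
  \<comment> \<open>Half of \<open>h_max\<close> keeps \<open>H\<close> strictly below it; the other
    entries enforce the step-size conditions of the locale. The \<open>+ 1\<close> keeps the last
    denominator positive, since \<open>D\<close> is only known to be nonnegative here.\<close>
  define H where "H = min (h_max / 2) (min (\<mu> / L\<^sup>2) (min (1 / \<mu>) (\<mu> / (4 * D * S\<^sup>2 + 1))))"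
  \<comment> \<open>The constant of \<open>weak_error\<close> with \<open>noise_const\<close>
    unfolded.\<close>
  define C where "C = 3 * (2 * D * S\<^sup>2 / \<mu>) + 2 / \<mu> * (6 * (K * (2 * D * S\<^sup>2) / \<mu>) + 2 * L\<^sup>2)"
  have denominator: "0 < 4 * D * S\<^sup>2 + 1"
    using D by (intro add_nonneg_pos) auto
  have H: "H \<in> {0<..<h_max}"
    using assms(1) L(1) \<mu>(1) denominator by (auto simp: H_def min_less_iff_disj)
  \<comment> \<open>Strict positivity comes from the term with \<open>L\<^sup>2\<close>; the others
    are only nonnegative.\<close>
  have C: "0 < C"
    unfolding C_def using L(1) \<mu>(1) K D by (intro add_nonneg_pos mult_pos_pos add_nonneg_pos) auto
  have main: "integrable M (\<lambda>\<omega>. \<phi> (sg_scheme F \<sigma> \<gamma> h x0 n \<omega>))"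
    "\<bar>(\<integral>\<omega>. \<phi> (sg_scheme F \<sigma> \<gamma> h x0 n \<omega>) \<partial>M) - \<phi> (\<X> (real n * h))\<bar>
      \<le> C * (norm (gradient \<phi> z) + deriv_norm 2 \<phi>) * (1 + norm (x0 - z) ^ 3) * h"
    if \<phi>: "class_C 2 \<phi>" "bounded_deriv 2 \<phi>" and h: "h \<in> {0<..<H}"
      and sol: "gradient_system_solution F x0 \<X>" for \<phi> x0 h \<X> n
  proof -
    have h_le: "0 < h" "h < \<mu> / L\<^sup>2" "h < 1 / \<mu>" "h < \<mu> / (4 * D * S\<^sup>2 + 1)"
      using h by (auto simp: H_def)
    have h_bounds: "h * L\<^sup>2 \<le> \<mu>" "h * \<mu> \<le> 1" "h * (4 * D * S\<^sup>2) \<le> \<mu>"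
    proof -
      show "h * L\<^sup>2 \<le> \<mu>"
        using h_le(2) L(1) by (simp add: pos_less_divide_eq)
      show "h * \<mu> \<le> 1"
        using h_le(3) \<mu>(1) by (simp add: pos_less_divide_eq)
      show "h * (4 * D * S\<^sup>2) \<le> \<mu>"
        using h_le(1,4) denominator by (simp add: pos_less_divide_eq distrib_left)
    qed
    \<comment> \<open>The locale is entered anew for every \<open>h\<close> and \<open>x0\<close>,
      but its constants depend on neither, so \<open>C\<close> is uniform.\<close>
    interpret sg_fixed_step M F \<sigma> \<gamma> L \<mu> K S D h z x0
      using F L \<mu> K third z \<sigma>_continuous \<sigma>_growth S(1) indep \<gamma>_square D h_le(1) h_bounds
        distributed_std_gaussian_moments(2,3)[OF gauss]
      by unfold_locales (auto simp: D_def)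
    have B: "\<bar>deriv_along [k, l] \<phi> x\<bar> \<le> deriv_norm 2 \<phi> * (norm k * norm l)" if "k \<noteq> 0" "l \<noteq> 0" for k l x
      using bounded_derivD[OF \<phi>(2), of "[k, l]" x] that by simp
    show "integrable M (\<lambda>\<omega>. \<phi> (sg_scheme F \<sigma> \<gamma> h x0 n \<omega>))"
      by (rule weak_error[OF sol \<phi>(1) deriv_norm_nonneg[OF \<phi>(2)] B])
    show "\<bar>(\<integral>\<omega>. \<phi> (sg_scheme F \<sigma> \<gamma> h x0 n \<omega>) \<partial>M) - \<phi> (\<X> (real n * h))\<bar>
      \<le> C * (norm (gradient \<phi> z) + deriv_norm 2 \<phi>) * (1 + norm (x0 - z) ^ 3) * h"
      using weak_error(2)[OF sol \<phi>(1) deriv_norm_nonneg[OF \<phi>(2)] B, of n]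
      unfolding C_def noise_const_def .
  qed
  show ?thesis
    unfolding z_def[symmetric]
    using main by (intro bexI[OF _ H] exI[of _ C] conjI C allI impI ballI SUP_least) auto
qed

end
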